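(* For every $\tau\in\mathcal{H}$ the following equalities hold: \[\theta\big[{\textstyle{1 \atop 1/3}}\big]'(\tau,0)=-\tfrac{\pi}{\sqrt{3}}\,\theta\big[{\textstyle{1 \atop 1/3}}\big](\tau,0)\,\Theta_{3}(2\tau),\] \[\theta\big[{\textstyle{0 \atop 1/3}}\big]'(\tau,0)=-\tfrac{\pi}{\sqrt{3}}\,\theta\big[{\textstyle{0 \atop 1/3}}\big](\tau,0)\Big(\Theta_{3}(\tau)-\Theta_{3}(2\tau)\Big),\] \[\theta\big[{\textstyle{1/3 \atop 1}}\big]'(\tau,0)=\tfrac{\pi i}{3}\,\theta\big[{\textstyle{1/3 \atop 1}}\big](\tau,0)\,\Theta_{3}\big(\tfrac{2\tau}{3}\big),\] \[\theta\big[{\textstyle{1/3 \atop 0}}\big]'(\tau,0)=\tfrac{\pi i}{3}\,\theta\big[{\textstyle{1/3 \atop 0}}\big](\tau,0)\Big(2\Theta_{3}\big(\tfrac{4\tau}{3}\big)-\Theta_{3}\big(\tfrac{2\tau}{3}\big)\Big),\] \[\theta\big[{\textstyle{1 \atop 2/3}}\big]'(\tau,0)=-\tfrac{\pi}{\sqrt{3}}\,\theta\big[{\textstyle{1 \atop 2/3}}\big](\tau,0)\Big(2\Theta_{3}(4\tau)+\Theta_{3}(2\tau)\Big),\] \[\theta\big[{\textstyle{0 \atop 2/3}}\big]'(\tau,0)=-\tfrac{\pi}{\sqrt{3}}\,\theta\big[{\textstyle{0 \atop 2/3}}\big](\tau,0)\Big(\Theta_{3}(\tau)+\Theta_{3}(2\tau)-2\Theta_{3}(4\tau)\Big),\]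 \[\theta\big[{\textstyle{2/3 \atop 1}}\big]'(\tau,0)=\tfrac{\pi i}{3}\,\theta\big[{\textstyle{2/3 \atop 1}}\big](\tau,0)\Big(\Theta_{3}\big(\tfrac{\tau}{3}\big)+\Theta_{3}\big(\tfrac{2\tau}{3}\big)\Big),\] \[\theta\big[{\textstyle{2/3 \atop 0}}\big]'(\tau,0)=\tfrac{\pi i}{3}\,\theta\big[{\textstyle{2/3 \atop 0}}\big](\tau,0)\Big(2\Theta_{3}\big(\tfrac{4\tau}{3}\big)-\Theta_{3}\big(\tfrac{\tau}{3}\big)+\Theta_{3}\big(\tfrac{2\tau}{3}\big)\Big).\]
   Context: $\mathcal{H}$ is the upper half-plane, $\mathbf{e}(u)=e^{2\pi iu}$, $q=\mathbf{e}(\tau)$ and $q^{r}=\mathbf{e}(r\tau)$ for rational $r$. For real $\varepsilon,\delta$, $\tau\in\mathcal{H}$ and $z\in\mathbb{C}$, the theta function with characteristics is \[\theta\big[{\textstyle{\varepsilon \atop \delta}}\big](\tau,z)=\sum_{n=-\infty}^{\infty}\mathbf{e}\Big[\big(n+\tfrac{\varepsilon}{2}\big)^{2}\tfrac{\tau}{2}+\big(n+\tfrac{\varepsilon}{2}\big)\big(z+\tfrac{\delta}{2}\big)\Big].\] The prime denotes differentiation with respect to $z$ only, so $\theta\big[{\varepsilon \atop \delta}\big]'(\tau,0)$ is the $z$-derivative at $z=0$. Let $\mathcal{O}_{3}=\mathbb{Z}[e^{2\pi i/3}]$ be the ring of integers of $\mathbb{Q}(\sqrt{-3})$, with norm $N(\alpha)=|\alpha|^{2}$,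 and set $\Theta_{3}(\tau)=\sum_{\alpha\in\mathcal{O}_{3}}q^{N(\alpha)/2}$ for $\tau\in\mathcal{H}$. *)

theory Defs
  imports "HOL-Analysis.Analysis" "HOL-Computational_Algebra.Polynomial"
begin

definition e2pi :: "complex \<Rightarrow> complex" where
  "e2pi u = exp (2 * of_real pi * \<i> * u)"

definition theta_char :: "real \<Rightarrow> real \<Rightarrow> complex \<Rightarrow> complex \<Rightarrow> complex" where
  "theta_char \<epsilon> \<delta> \<tau> z =
     (\<Sum>\<^sub>\<infinity>n\<in>(UNIV :: int set).
        e2pi ((of_int n + of_real \<epsilon> / 2)\<^sup>2 * \<tau> / 2
              + (of_int n + of_real \<epsilon> / 2) * (z + of_real \<delta> / 2)))"

definition omega3 :: complex where
  "omega3 = exp (2 * of_real pi * \<i> / 3)"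

(* Z[omega3]: the subring of the complex numbers generated by omega3 *)
definition O3 :: "complex set" where
  "O3 = range (\<lambda>p :: int poly. poly (map_poly of_int p) omega3)"

definition O3_norm :: "complex \<Rightarrow> real" where
  "O3_norm \<alpha> = (cmod \<alpha>)\<^sup>2"

definition Theta3 :: "complex \<Rightarrow> complex" where
  "Theta3 \<tau> = (\<Sum>\<^sub>\<infinity>\<alpha>\<in>O3. e2pi (of_real (O3_norm \<alpha> / 2) * \<tau>))"

lemma omega3_square: "omega3\<^sup>2 = - 1 - omega3"
proof -
  have "omega3 = cis (2 * pi / 3)"
    by (simp add: omega3_def cis_conv_exp mult_ac)
  then have ReIm: "Re omega3 = - 1 / 2" "Im omega3 = sqrt 3 / 2"
    by (metis cis.sel(1) cos_120, metis cis.sel(2) sin_120)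
  show ?thesis
    by (simp add: complex_eq_iff power2_eq_square ReIm)
qed

lemma O3_eq: "O3 = {of_int a + of_int b * omega3 | a b :: int. True}"
proof (intro equalityI subsetI)
  fix x assume "x \<in> O3"
  then obtain p :: "int poly" where x: "x = poly (map_poly of_int p) omega3"
    by (auto simp: O3_def)
  have "\<exists>a b :: int. poly (map_poly of_int p) omega3 = of_int a + of_int b * omega3"
  proof (induction p)
    case 0
    show ?case by (rule exI[of _ 0], rule exI[of _ 0]) simp
  next
    case (pCons c p)
    then obtain a b :: int
      where ab: "poly (map_poly of_int p) omega3 = of_int a + of_int b * omega3"
      by blast
    have "poly (map_poly of_int (pCons c p)) omega3
        = of_int c + omega3 * (of_int a + of_int b * omega3)"
      using ab by (simp add: map_poly_pCons)
    also have "\<dots> = of_int c + of_int a * omega3 + of_int b * omega3\<^sup>2"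
      by (simp add: algebra_simps power2_eq_square)
    also have "\<dots> = of_int (c - b) + of_int (a - b) * omega3"
      by (simp add: omega3_square algebra_simps)
    finally show ?case by blast
  qed
  then show "x \<in> {of_int a + of_int b * omega3 | a b :: int. True}"
    using x by blast
next
  fix x assume "x \<in> {of_int a + of_int b * omega3 | a b :: int. True}"
  then obtain a b :: int where "x = of_int a + of_int b * omega3" by blast
  then have "x = poly (map_poly of_int [:a, b:]) omega3"
    by (simp add: map_poly_pCons mult.commute)
  then show "x \<in> O3" unfolding O3_def by blast
qed

end

theory Submission
  imports Defs "HOL-Complex_Analysis.Cauchy_Integral_Formula"
begin

text \<open>
  Absorb the second characteristic into the argument and write
  \<open>\<theta>\<^sub>r(\<tau>, u)\<close> for the sum of \<open>e((n + r)\<^sup>2 \<tau>/2 + (n + r) u)\<close> over the integers \<open>n\<close>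
  (\<open>theta\<close> below). The theta functions of the theorem and their derivatives are then values and
  \<open>u\<close>-derivatives of \<open>\<theta>\<^sub>r\<close> at points where \<open>r\<close> and \<open>u\<close> are multiples of \<open>1/6\<close>, and each equality
  gives the logarithmic derivative of \<open>\<theta>\<^sub>r\<close> there.

  Two of the eight equalities, those for \<open>\<theta>\<^sub>1\<^sub>/\<^sub>2(\<tau>, 1/6)\<close> and
  \<open>\<theta>\<^sub>1\<^sub>/\<^sub>6(\<tau>, 1/2)\<close>, carry the content. They come from the cube of a theta function.
  The cube is a sum over \<open>\<int>\<^sup>3\<close>; splitting an integer vector into its component along
  \<open>(1,1,1)\<close> and its component orthogonal to it gives (\<open>theta_cubed\<close>)
  \<open>\<theta>\<^sub>1\<^sub>/\<^sub>2(\<tau>, u)\<^sup>3 = a B(3u) + c (F(3u) + F(-3u))\<close> with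
  \<open>B = \<theta>\<^sub>1\<^sub>/\<^sub>2(3\<tau>, \<cdot>)\<close> and \<open>F = \<theta>\<^sub>1\<^sub>/\<^sub>6(3\<tau>, \<cdot>)\<close>. The coefficient \<open>a\<close> is the
  theta series of the orthogonal lattice, which is the hexagonal lattice of Eisenstein integers, so
  \<open>a = \<Theta>\<^sub>3(2\<tau>)\<close>; and \<open>c\<close> belongs to its nontrivial cosets in the dual lattice. As \<open>B\<close> and
  \<open>\<theta>\<^sub>1\<^sub>/\<^sub>2(\<tau>, \<cdot>)\<close> vanish at \<open>1/2\<close>, the identity at \<open>u = 1/6\<close> and its derivatives at
  \<open>u = 1/6\<close> and \<open>u = 1/2\<close> are three relations between \<open>a B'(1/2)\<close>, \<open>c\<close>,
  \<open>F\<close>, \<open>F'\<close> and the value and derivative of \<open>\<theta>\<^sub>1\<^sub>/\<^sub>2(\<tau>, \<cdot>)\<close> at \<open>1/6\<close>.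

  One more relation is needed to eliminate \<open>B'(1/2)\<close> and \<open>c\<close>: that
  \<open>B'(1/2)\<close> is an explicit constant times \<open>\<theta>\<^sub>1\<^sub>/\<^sub>2(\<tau>, 1/6)\<^sup>3\<close>. By the Jacobi triple product both
  sides are multiples of \<open>q\<^sup>3\<^sup>/\<^sup>8 \<Prod>(1 - q\<^sup>3\<^sup>k)\<^sup>3\<close>, the left one because the linear factor that
  vanishes at \<open>1/2\<close> is removed, the right one because
  \<open>(1 - y)(1 + y e(1/6))(1 + y e(-1/6)) = 1 - y\<^sup>3\<close>. The triple product also shows that the
  theta functions are nonzero where division is required. It is proved as the limit of its finite form, a
  rewriting of the \<open>q\<close>-binomial theorem (\<open>q_binomial_theorem\<close>, \<open>finite_Jacobi_triple_product\<close>,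
  \<open>theta_product_tendsto\<close>).

  The other six equalities follow from two duplication formulas,
  \<open>\<theta>\<^sub>r(\<tau>, u) \<theta>\<^sub>r(\<tau>, u + 1/2) = K \<theta>\<^sub>r(2\<tau>, 2u + 1/2)\<close> and
  \<open>\<theta>\<^sub>r(\<tau>, u) \<theta>\<^sub>r\<^sub>+\<^sub>1\<^sub>/\<^sub>2(\<tau>, u) = K' \<theta>\<^sub>2\<^sub>r\<^sub>+\<^sub>1\<^sub>/\<^sub>2(\<tau>/2, u)\<close>, whose logarithmic derivatives
  express a new value through known ones at \<open>\<tau>\<close> and at \<open>2\<tau>\<close> or \<open>\<tau>/2\<close>.
\<close>

section \<open>Dominated unordered sums\<close>

text \<open>The error of a partial sum is at most the tail of \<open>\<Sum> M\<close>, which does not involve \<open>x\<close>.\<close>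
lemma uniform_limit_infsum_M_test:
  fixes f :: "'i \<Rightarrow> 'a \<Rightarrow> complex"
  assumes M: "M summable_on A" and le: "\<And>x n. x \<in> S \<Longrightarrow> n \<in> A \<Longrightarrow> norm (f n x) \<le> M n"
  shows "uniform_limit S (\<lambda>X x. \<Sum>n\<in>X. f n x) (\<lambda>x. \<Sum>\<^sub>\<infinity>n\<in>A. f n x) (finite_subsets_at_top A)"
proof (rule uniform_limitI)
  fix e :: real assume e: "e > 0"
  have "eventually (\<lambda>X. dist (sum M X) (infsum M A) < e) (finite_subsets_at_top A)"
    using has_sum_infsum[OF M] e unfolding has_sum_def tendsto_iff by blast
  moreover have "eventually (\<lambda>X. finite X \<and> X \<subseteq> A) (finite_subsets_at_top A)"
    by (simp add: eventually_finite_subsets_at_top_weakI)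
  ultimately show "\<forall>\<^sub>F X in finite_subsets_at_top A.
      \<forall>x\<in>S. dist (\<Sum>n\<in>X. f n x) (\<Sum>\<^sub>\<infinity>n\<in>A. f n x) < e"
  proof eventually_elim
    case (elim X)
    then have X: "finite X" "X \<subseteq> A" "dist (sum M X) (infsum M A) < e" by auto
    have MD: "M summable_on A - X"
      using M by (rule summable_on_subset) auto
    have sM: "infsum M A = sum M X + infsum M (A - X)"
    proof -
      have "infsum M (X \<union> (A - X)) = infsum M X + infsum M (A - X)"
        by (rule infsum_Un_disjoint) (use X MD in auto)
      moreover have "X \<union> (A - X) = A" using X by auto
      ultimately show ?thesis using X by simp
    qed
    show ?case
    proof
      fix x assume x: "x \<in> S"
      have abs: "(\<lambda>n. norm (f n x)) summable_on A - X"
        by (rule Infinite_Sum.abs_summable_on_comparison_test'[OF MD]) (use le x in auto)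
      have sD: "(\<lambda>n. f n x) summable_on A - X"
        using abs by (rule abs_summable_summable)
      have "infsum (\<lambda>n. f n x) (X \<union> (A - X)) = infsum (\<lambda>n. f n x) X + infsum (\<lambda>n. f n x) (A - X)"
        by (rule infsum_Un_disjoint) (use X sD in auto)
      moreover have "X \<union> (A - X) = A" using X by auto
      ultimately have "dist (\<Sum>n\<in>X. f n x) (\<Sum>\<^sub>\<infinity>n\<in>A. f n x) = norm (infsum (\<lambda>n. f n x) (A - X))"
        using X by (simp add: dist_norm)
      also have "\<dots> \<le> infsum (\<lambda>n. norm (f n x)) (A - X)"
        by (rule norm_infsum_bound[OF abs])
      also have "\<dots> \<le> infsum M (A - X)"
        by (rule infsum_mono[OF abs MD]) (use le x in auto)
      also have "\<dots> < e" using X(3) sM by (simp add: dist_real_def)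
      finally show "dist (\<Sum>n\<in>X. f n x) (\<Sum>\<^sub>\<infinity>n\<in>A. f n x) < e" .
    qed
  qed
qed

text \<open>Tannery's theorem: the domination makes the partial sums converge uniformly in the
  parameter, so the limit in the parameter and the limit over finite index sets may be exchanged.\<close>
lemma tendsto_infsum_dominated:
  fixes f :: "'i \<Rightarrow> 'b \<Rightarrow> complex"
  assumes M: "M summable_on A" and le: "\<And>N n. n \<in> A \<Longrightarrow> norm (f n N) \<le> M n"
    and lim: "\<And>n. n \<in> A \<Longrightarrow> (f n \<longlongrightarrow> g n) F" and F: "F \<noteq> bot"
  shows "((\<lambda>N. \<Sum>\<^sub>\<infinity>n\<in>A. f n N) \<longlongrightarrow> (\<Sum>\<^sub>\<infinity>n\<in>A. g n)) F"
proof (rule swap_uniform_limit')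
  show "uniform_limit UNIV (\<lambda>X N. \<Sum>n\<in>X. f n N) (\<lambda>N. \<Sum>\<^sub>\<infinity>n\<in>A. f n N) (finite_subsets_at_top A)"
    by (rule uniform_limit_infsum_M_test[OF M]) (use le in auto)
  have "norm (g n) \<le> M n" if "n \<in> A" for n
    by (rule Lim_norm_ubound[OF F lim[OF that]]) (use le[OF that] in auto)
  then have "(\<lambda>n. norm (g n)) summable_on A"
    by (intro Infinite_Sum.abs_summable_on_comparison_test'[OF M])
  then show "((\<lambda>X. \<Sum>n\<in>X. g n) \<longlongrightarrow> (\<Sum>\<^sub>\<infinity>n\<in>A. g n)) (finite_subsets_at_top A)"
    using has_sum_infsum[OF abs_summable_summable] unfolding has_sum_def by blast
  have "eventually (\<lambda>X. X \<subseteq> A) (finite_subsets_at_top A)"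
    by (simp add: eventually_finite_subsets_at_top_weakI)
  then show "\<forall>\<^sub>F X in finite_subsets_at_top A. ((\<lambda>N. \<Sum>n\<in>X. f n N) \<longlongrightarrow> (\<Sum>n\<in>X. g n)) F"
    by eventually_elim (intro tendsto_sum lim, auto)
qed auto

lemma has_sum_Times_mult:
  fixes f :: "'a \<Rightarrow> complex" and g :: "'b \<Rightarrow> complex"
  assumes f: "(\<lambda>x. norm (f x)) summable_on A" and g: "(\<lambda>y. norm (g y)) summable_on B"
  shows "((\<lambda>(x, y). f x * g y) has_sum (infsum f A * infsum g B)) (A \<times> B)"
    and "(\<lambda>p. norm (case p of (x, y) \<Rightarrow> f x * g y)) summable_on A \<times> B"
proof -
  show abs: "(\<lambda>p. norm (case p of (x, y) \<Rightarrow> f x * g y)) summable_on A \<times> B"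
    unfolding Infinite_Sum.abs_summable_on_Sigma_iff
    using f g by (auto simp: norm_mult abs_mult infsum_nonneg infsum_cmult_right' intro: summable_on_cmult_left summable_on_cmult_right)
  have s: "(\<lambda>(x, y). f x * g y) summable_on A \<times> B"
    using abs by (rule abs_summable_summable)
  have "infsum (\<lambda>(x, y). f x * g y) (A \<times> B) = infsum (\<lambda>x. infsum (\<lambda>y. f x * g y) B) A"
    using infsum_Sigma'_banach[OF s] by simp
  also have "\<dots> = infsum f A * infsum g B"
    by (simp add: infsum_cmult_right' infsum_cmult_left')
  finally show "((\<lambda>(x, y). f x * g y) has_sum (infsum f A * infsum g B)) (A \<times> B)"
    using has_sum_infsum[OF s] by simp
qed

lemma summable_on_exp_minus_abs_int: "(\<lambda>n::int. exp (- \<bar>real_of_int n\<bar>)) summable_on UNIV"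
proof -
  have g: "(\<lambda>k. exp (- 1 :: real) ^ k) summable_on (UNIV :: nat set)"
    by (intro norm_summable_imp_summable_on summable_norm summable_geometric) auto
  have e: "exp (- 1 :: real) ^ k = exp (- real k)" for k
    by (simp add: exp_of_nat_mult[symmetric])
  have 1: "(\<lambda>n::int. exp (- \<bar>real_of_int n\<bar>)) summable_on {0..}"
    using g summable_on_reindex_bij_witness[of UNIV nat int "{0..}"
      "\<lambda>n::int. exp (- \<bar>real_of_int n\<bar>)" "\<lambda>k. exp (- 1 :: real) ^ k"]
    by (auto simp: e)
  have 2: "(\<lambda>n::int. exp (- \<bar>real_of_int n\<bar>)) summable_on {..0}"
    using g summable_on_reindex_bij_witness[of UNIV "\<lambda>n. nat (- n)" "\<lambda>k. - int k" "{..0}"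
      "\<lambda>n::int. exp (- \<bar>real_of_int n\<bar>)" "\<lambda>k. exp (- 1 :: real) ^ k"]
    by (auto simp: e)
  have "UNIV = {0..} \<union> {..0::int}" by auto
  then show ?thesis using summable_on_union[OF 1 2] by simp
qed

section \<open>Theta series with shifted index\<close>

lemma e2pi_add: "e2pi (x + y) = e2pi x * e2pi y"
  by (simp add: e2pi_def exp_add ring_distribs)

lemma norm_e2pi: "norm (e2pi x) = exp (- 2 * pi * Im x)"
  by (simp add: e2pi_def)

lemma e2pi_of_real: "e2pi (of_real x) = cis (2 * pi * x)"
  by (simp add: e2pi_def cis_conv_exp mult_ac)

lemma e2pi_of_int [simp]: "e2pi (of_int n) = 1"
  using e2pi_of_real[of "of_int n"] by simp

lemma e2pi_nonzero [simp]: "e2pi x \<noteq> 0"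
  by (simp add: e2pi_def)

text \<open>The series with characteristics \<open>\<epsilon> = 2r\<close> and \<open>\<delta> = 0\<close>. A second characteristic is only a
  translation of \<open>u\<close>, so the argument carries it.\<close>
definition theta_term :: "real \<Rightarrow> complex \<Rightarrow> complex \<Rightarrow> int \<Rightarrow> complex" where
  "theta_term r \<tau> u n =
     e2pi ((of_int n + of_real r)\<^sup>2 * \<tau> / 2 + (of_int n + of_real r) * u)"

definition theta :: "real \<Rightarrow> complex \<Rightarrow> complex \<Rightarrow> complex" where
  "theta r \<tau> u = (\<Sum>\<^sub>\<infinity>n. theta_term r \<tau> u n)"

lemma theta_char_eq: "theta_char \<epsilon> \<delta> \<tau> z = theta (\<epsilon> / 2) \<tau> (z + of_real \<delta> / 2)"
  by (simp add: theta_char_def theta_def theta_term_def)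

lemma norm_theta_term:
  "norm (theta_term r \<tau> u n)
     = exp (- pi * (of_int n + r)\<^sup>2 * Im \<tau> - 2 * pi * (of_int n + r) * Im u)"
proof -
  have "(of_int n + of_real r)\<^sup>2 * \<tau> / 2 + (of_int n + of_real r) * u
      = of_real ((of_int n + r)\<^sup>2 / 2) * \<tau> + of_real (of_int n + r) * u"
    by simp
  then show ?thesis
    unfolding theta_term_def norm_e2pi by (simp only: Im_complex_of_real plus_complex.sel
        times_complex.sel Re_complex_of_real) (simp add: algebra_simps)
qed

text \<open>On a horizontal strip the quadratic term in the exponent dominates the linear one: completing the
  square bounds the exponent by \<open>C - \<bar>n\<bar>\<close>.\<close>
lemma theta_term_dominated:
  assumes y: "Im \<tau> > 0"
  obtains M where "M summable_on UNIV"
    "\<And>u n. \<bar>Im u\<bar> \<le> R \<Longrightarrow> norm (theta_term r \<tau> u n) \<le> M n"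
proof -
  define a where "a = pi * Im \<tau>"
  (* b exceeds the linear coefficient by 1, which leaves exp (- s) after completing the square *)
  define b where "b = 2 * pi * R + 1"
  define C where "C = b\<^sup>2 / (4 * a) + \<bar>r\<bar>"
  have a: "a > 0" using y by (simp add: a_def)
  show ?thesis
  proof (rule that)
    show "(\<lambda>n::int. exp C * exp (- \<bar>real_of_int n\<bar>)) summable_on UNIV"
      by (intro summable_on_cmult_right summable_on_exp_minus_abs_int)
    fix u n assume u: "\<bar>Im u\<bar> \<le> R"
    define s where "s = \<bar>of_int n + r\<bar>"
    have "- 2 * pi * (of_int n + r) * Im u \<le> 2 * pi * (s * \<bar>Im u\<bar>)"
      using abs_ge_minus_self[of "2 * pi * (of_int n + r) * Im u"]
      by (simp add: abs_mult s_def)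
    also have "\<dots> \<le> 2 * pi * (s * R)"
      using u by (intro mult_left_mono) (auto simp: s_def)
    finally have 1: "- 2 * pi * (of_int n + r) * Im u \<le> 2 * pi * (s * R)" .
    have "0 \<le> (2 * a * s - b)\<^sup>2" by simp
    then have "4 * a * (b * s - a * s\<^sup>2) \<le> b\<^sup>2"
      by (simp add: power2_eq_square algebra_simps)
    then have 2: "b * s - a * s\<^sup>2 \<le> b\<^sup>2 / (4 * a)"
      using a by (simp add: field_simps)
    have 3: "\<bar>real_of_int n\<bar> \<le> s + \<bar>r\<bar>" unfolding s_def by linarith
    have 4: "pi * (of_int n + r)\<^sup>2 * Im \<tau> = a * s\<^sup>2"
      by (simp add: a_def s_def)
    have 5: "b * s = 2 * pi * (s * R) + s" by (simp add: b_def algebra_simps)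
    have "- pi * (of_int n + r)\<^sup>2 * Im \<tau> - 2 * pi * (of_int n + r) * Im u \<le> C - \<bar>real_of_int n\<bar>"
      using 1 2 3 4 5 unfolding C_def by linarith
    then show "norm (theta_term r \<tau> u n) \<le> exp C * exp (- \<bar>real_of_int n\<bar>)"
      unfolding norm_theta_term by (simp flip: exp_add)
  qed
qed

lemma theta_term_abs_summable:
  assumes "Im \<tau> > 0"
  shows "(\<lambda>n. norm (theta_term r \<tau> u n)) summable_on UNIV"
proof -
  obtain M where "M summable_on UNIV"
    "\<And>v n. \<bar>Im v\<bar> \<le> \<bar>Im u\<bar> \<Longrightarrow> norm (theta_term r \<tau> v n) \<le> M n"
    by (rule theta_term_dominated[OF assms, where R = "\<bar>Im u\<bar>" and r = r]) blast
  then show ?thesis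
    by (intro Infinite_Sum.abs_summable_on_comparison_test'[of M]) auto
qed

lemma theta_has_sum:
  assumes "Im \<tau> > 0"
  shows "(theta_term r \<tau> u has_sum theta r \<tau> u) UNIV"
  unfolding theta_def
  by (rule has_sum_infsum[OF abs_summable_summable[OF theta_term_abs_summable[OF assms]]])

text \<open>Locally uniform limits of holomorphic functions may be differentiated termwise. That the differentiated
  series is summable is used when the triple product is differentiated.\<close>
lemma theta_has_field_derivative:
  assumes "Im \<tau> > 0"
  shows "\<exists>D. (theta r \<tau> has_field_derivative D) (at u) \<and>
     ((\<lambda>n. 2 * of_real pi * \<i> * (of_int n + of_real r) * theta_term r \<tau> u n) has_sum D) UNIV"
proof -
  obtain M where M: "M summable_on UNIV"
    "\<And>v n. \<bar>Im v\<bar> \<le> \<bar>Im u\<bar> + 1 \<Longrightarrow> norm (theta_term r \<tau> v n) \<le> M n"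
    by (rule theta_term_dominated[OF assms, where R = "\<bar>Im u\<bar> + 1" and r = r]) blast
  let ?t' = "\<lambda>n v. 2 * of_real pi * \<i> * (of_int n + of_real r) * theta_term r \<tau> v n"
  have D: "((\<lambda>v. theta_term r \<tau> v n) has_field_derivative ?t' n v) (at v)" for n v
    unfolding theta_term_def e2pi_def
    by (rule derivative_eq_intros refl)+ simp
  have "uniform_limit (cball u 1) (\<lambda>X v. \<Sum>n\<in>X. theta_term r \<tau> v n)
      (\<lambda>v. \<Sum>\<^sub>\<infinity>n. theta_term r \<tau> v n) (finite_subsets_at_top UNIV)"
  proof (rule uniform_limit_infsum_M_test[OF M(1)])
    fix v n assume "v \<in> cball u 1"
    then have "norm (u - v) \<le> 1" by (simp add: dist_norm)
    then have "\<bar>Im (u - v)\<bar> \<le> 1" using abs_Im_le_cmod[of "u - v"] by linarith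
    then show "norm (theta_term r \<tau> v n) \<le> M n" by (intro M(2)) auto
  qed
  then have ul: "uniform_limit (cball u 1) (\<lambda>X v. \<Sum>n\<in>X. theta_term r \<tau> v n)
      (theta r \<tau>) (finite_subsets_at_top UNIV)"
    by (simp add: theta_def[abs_def])
  have sumD: "((\<lambda>v. \<Sum>n\<in>X. theta_term r \<tau> v n) has_field_derivative (\<Sum>n\<in>X. ?t' n v)) (at v)" for X v
    by (intro DERIV_sum D)
  have "continuous_on (cball u 1) (\<lambda>v. \<Sum>n\<in>X. theta_term r \<tau> v n)" for X
    using DERIV_continuous_on[OF has_field_derivative_at_within[OF sumD]] .
  then have "\<forall>\<^sub>F X in finite_subsets_at_top UNIV.
      continuous_on (cball u 1) (\<lambda>v. \<Sum>n\<in>X. theta_term r \<tau> v n) \<and>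
      (\<forall>w\<in>ball u 1. ((\<lambda>v. \<Sum>n\<in>X. theta_term r \<tau> v n) has_field_derivative (\<Sum>n\<in>X. ?t' n w)) (at w))"
    using sumD by auto
  then obtain g' where g': "\<And>w. w \<in> ball u 1 \<Longrightarrow> (theta r \<tau> has_field_derivative g' w) (at w) \<and>
      ((\<lambda>X. \<Sum>n\<in>X. ?t' n w) \<longlongrightarrow> g' w) (finite_subsets_at_top UNIV)"
    by (rule has_complex_derivative_uniform_limit[OF _ ul finite_subsets_at_top_neq_bot zero_less_one]) blast
  then show ?thesis
    unfolding has_sum_def using g'[of u] by (intro exI[of _ "g' u"]) simp
qed

lemma theta_DERIV:
  assumes "Im \<tau> > 0"
  shows "(theta r \<tau> has_field_derivative deriv (theta r \<tau>) u) (at u)"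
  using theta_has_field_derivative[OF assms] DERIV_imp_deriv by metis

lemma theta_DERIV_compose:
  assumes "Im \<tau> > 0" and "(f has_field_derivative f') (at z)"
  shows "((\<lambda>z. theta r \<tau> (f z)) has_field_derivative deriv (theta r \<tau>) (f z) * f') (at z)"
  using DERIV_chain2[OF theta_DERIV[OF assms(1)] assms(2)] .

lemma deriv_theta_char:
  assumes "Im \<tau> > 0"
  shows "deriv (\<lambda>z. theta_char \<epsilon> \<delta> \<tau> z) 0 = deriv (theta (\<epsilon> / 2) \<tau>) (of_real \<delta> / 2)"
proof -
  have "((\<lambda>z. theta (\<epsilon> / 2) \<tau> (z + of_real \<delta> / 2)) has_field_derivative
      deriv (theta (\<epsilon> / 2) \<tau>) (0 + of_real \<delta> / 2) * 1) (at 0)"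
    by (rule theta_DERIV_compose[OF assms]) (auto intro!: derivative_eq_intros)
  then show ?thesis by (simp add: theta_char_eq DERIV_imp_deriv)
qed

lemma theta_add_one: "theta r \<tau> (u + 1) = e2pi (of_real r) * theta r \<tau> u"
proof -
  have "theta_term r \<tau> (u + 1) n = e2pi (of_real r) * theta_term r \<tau> u n" for n
    using e2pi_of_int[of n]
    by (simp add: theta_term_def ring_distribs e2pi_add del: e2pi_of_int)
  then show ?thesis by (simp add: theta_def infsum_cmult_right')
qed

lemma theta_shift_one: "theta (r + 1) \<tau> u = theta r \<tau> u"
  unfolding theta_def
  by (rule infsum_reindex_bij_witness[of _ "\<lambda>n. n - 1" "\<lambda>n. n + 1"])
     (auto simp: theta_term_def add_ac)

lemma theta_minus: "theta (- r) \<tau> (- u) = theta r \<tau> u"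
  unfolding theta_def
proof (rule infsum_reindex_bij_witness[of _ uminus uminus])
  fix n :: int
  have *: "of_int n - of_real r = - (of_int (- n) + of_real r :: complex)" by simp
  show "theta_term r \<tau> u (- n) = theta_term (- r) \<tau> (- u) n"
    unfolding theta_term_def of_real_minus add_uminus_conv_diff * by (simp add: algebra_simps power2_eq_square)
qed auto

lemma deriv_theta_add_one:
  assumes "Im \<tau> > 0"
  shows "deriv (theta r \<tau>) (u + 1) = e2pi (of_real r) * deriv (theta r \<tau>) u"
proof -
  have "((\<lambda>u. theta r \<tau> (u + 1)) has_field_derivative deriv (theta r \<tau>) (u + 1) * 1) (at u)"
    by (rule theta_DERIV_compose[OF assms]) (auto intro!: derivative_eq_intros)
  moreover have "((\<lambda>u. theta r \<tau> (u + 1)) has_field_derivative e2pi (of_real r) * deriv (theta r \<tau>) u) (at u)"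
    unfolding theta_add_one by (intro DERIV_cmult theta_DERIV assms)
  ultimately show ?thesis using DERIV_unique by fastforce
qed

lemma deriv_theta_minus:
  assumes "Im \<tau> > 0"
  shows "deriv (theta (- r) \<tau>) (- u) = - deriv (theta r \<tau>) u"
proof -
  have "((\<lambda>u. theta (- r) \<tau> (- u)) has_field_derivative deriv (theta (- r) \<tau>) (- u) * (- 1)) (at u)"
    by (rule theta_DERIV_compose[OF assms]) (auto intro!: derivative_eq_intros)
  moreover have "((\<lambda>u. theta (- r) \<tau> (- u)) has_field_derivative deriv (theta r \<tau>) u) (at u)"
    unfolding theta_minus by (intro theta_DERIV assms)
  ultimately show ?thesis using DERIV_unique by fastforce
qed

lemma deriv_theta_shift_one: "deriv (theta (r + 1) \<tau>) u = deriv (theta r \<tau>) u"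
proof -
  have "theta (r + 1) \<tau> = theta r \<tau>" by (rule ext) (rule theta_shift_one)
  then show ?thesis by simp
qed

lemma e2pi_half: "e2pi (1/2) = - 1"
  using e2pi_of_real[of "1/2"] by simp

text \<open>Jacobi's odd theta function, translated by \<open>1/2\<close>. Translation by \<open>1\<close> changes its sign and
  \<open>u \<mapsto> - u\<close> does not, so \<open>u \<mapsto> 1 - u\<close> changes its sign.\<close>
lemma theta_half_half: "theta (1/2) \<tau> (1/2) = 0"
proof -
  have "theta (1/2) \<tau> (1/2) = theta (1/2) \<tau> (- (1/2) + 1)" by simp
  also have "\<dots> = - theta (1/2) \<tau> (- (1/2))"
    by (subst theta_add_one) (simp add: e2pi_half)
  also have "theta (1/2) \<tau> (- (1/2)) = theta (- (1/2)) \<tau> (1/2)"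
    using theta_minus[of "1/2" \<tau> "- (1/2)"] by simp
  also have "\<dots> = theta (1/2) \<tau> (1/2)"
    using theta_shift_one[of "- (1/2)" \<tau> "1/2"] by simp
  finally show ?thesis by simp
qed

section \<open>Lattice decompositions of products\<close>

text \<open>The map \<open>(m, n) \<mapsto> (m + n, m - n)\<close> diagonalises \<open>m\<^sup>2 + n\<^sup>2\<close>; its image consists of the
  pairs of equal parity, and the parity is the index \<open>j\<close> of the two summands.\<close>
lemma theta_mult_theta:
  assumes "Im \<tau> > 0"
  shows "theta r \<tau> u * theta s \<tau> v
    = theta ((r + s) / 2) (2 * \<tau>) (u + v) * theta ((r - s) / 2) (2 * \<tau>) (u - v)
      + theta ((r + s + 1) / 2) (2 * \<tau>) (u + v) * theta ((r - s + 1) / 2) (2 * \<tau>) (u - v)"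
proof -
  have y2: "Im (2 * \<tau>) > 0" using assms by simp
  define F where "F = (\<lambda>(m, n). theta_term r \<tau> u m * theta_term s \<tau> v n)"
  define P where "P = (\<lambda>j. theta ((r + s + of_int j) / 2) (2 * \<tau>) (u + v)
      * theta ((r - s + of_int j) / 2) (2 * \<tau>) (u - v))"
  define g :: "int \<times> int \<times> int \<Rightarrow> int \<times> int" where "g = (\<lambda>(j, p, l). (p + l + j, p - l))"
  have "bij_betw g ({0, 1} \<times> UNIV) (UNIV \<times> UNIV)"
  proof (rule bij_betw_byWitness[where f' = "\<lambda>(m, n). ((m - n) mod 2, n + (m - n) div 2, (m - n) div 2)"])
    have "(p + l + j - (p - l)) mod 2 = j \<and> (p + l + j - (p - l)) div 2 = l" if "j \<in> {0, 1}" for j p l :: int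
      using that by auto
    then show "\<forall>a\<in>{0, 1} \<times> UNIV. (case g a of (m, n) \<Rightarrow> ((m - n) mod 2, n + (m - n) div 2, (m - n) div 2)) = a"
      by (simp add: g_def)
    have "n + (m - n) div 2 + (m - n) div 2 + (m - n) mod 2 = m" for m n :: int
      using div_mult_mod_eq[of "m - n" 2] by linarith
    then show "\<forall>b\<in>UNIV \<times> UNIV. g (case b of (m, n) \<Rightarrow> ((m - n) mod 2, n + (m - n) div 2, (m - n) div 2)) = b"
      by (simp add: g_def)
  qed (auto simp: g_def)
  note reindex = has_sum_reindex_bij_betw[OF this, of F]
  have "(F has_sum theta r \<tau> u * theta s \<tau> v) (UNIV \<times> UNIV)"
    unfolding F_def theta_def by (intro has_sum_Times_mult theta_term_abs_summable assms)
  also have "?this \<longleftrightarrow> ((\<lambda>(j, p, l). F (p + l + j, p - l)) has_sum theta r \<tau> u * theta s \<tau> v)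
      ({0, 1} \<times> UNIV)"
    unfolding reindex[symmetric] g_def by (simp only: case_prod_unfold)
  finally have total: "((\<lambda>(j, p, l). F (p + l + j, p - l)) has_sum theta r \<tau> u * theta s \<tau> v)
      ({0, 1} \<times> UNIV)" .
  have part: "((\<lambda>(p, l). F (p + l + j, p - l)) has_sum P j) UNIV" for j :: int
  proof -
    have "F (p + l + j, p - l) = theta_term ((r + s + of_int j) / 2) (2 * \<tau>) (u + v) p
      * theta_term ((r - s + of_int j) / 2) (2 * \<tau>) (u - v) l" for p l
    proof -
      define \<alpha> \<beta> :: complex where "\<alpha> = of_int p + of_real ((r + s + of_int j) / 2)"
        and "\<beta> = of_int l + of_real ((r - s + of_int j) / 2)"
      have *: "of_int (p + l + j) + of_real r = \<alpha> + \<beta>" "of_int (p - l) + of_real s = \<alpha> - \<beta>"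
        by (simp_all add: \<alpha>_def \<beta>_def field_simps)
      show ?thesis
        unfolding F_def theta_term_def prod.case e2pi_add[symmetric] * \<alpha>_def[symmetric] \<beta>_def[symmetric]
        by (rule arg_cong[of _ _ e2pi]) (simp add: field_simps power2_eq_square)
    qed
    then show ?thesis
      using has_sum_Times_mult(1)[OF theta_term_abs_summable theta_term_abs_summable, OF y2 y2,
          of "(r + s + of_int j) / 2" "u + v" "(r - s + of_int j) / 2" "u - v"]
      by (simp add: P_def theta_def)
  qed
  have "(P has_sum theta r \<tau> u * theta s \<tau> v) {0, 1}"
    by (rule has_sum_SigmaD[OF total]) (use part in auto)
  moreover have "(P has_sum (\<Sum>j\<in>{0,1}. P j)) {0, 1}"
    by (rule has_sum_finite) auto
  ultimately have "theta r \<tau> u * theta s \<tau> v = (\<Sum>j\<in>{0,1}. P j)"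
    by (rule has_sum_unique)
  then show ?thesis by (simp add: P_def)
qed

text \<open>The theta series of a coset of the lattice \<open>A\<^sub>2 = {l \<in> \<int>\<^sup>3. l\<^sub>1 + l\<^sub>2 + l\<^sub>3 = 0}\<close> in its dual: the
  points \<open>l - (j/3, j/3, j/3)\<close> with \<open>l \<in> \<int>\<^sup>3\<close> and \<open>l\<^sub>1 + l\<^sub>2 + l\<^sub>3 = j\<close>. It depends only on \<open>j\<close>
  modulo \<open>3\<close>.\<close>
definition A2_coset_theta :: "int \<Rightarrow> complex \<Rightarrow> complex" where
  "A2_coset_theta j \<tau> = (\<Sum>\<^sub>\<infinity>(a, b)\<in>(UNIV :: (int \<times> int) set).
     e2pi (((of_int a - of_int j / 3)\<^sup>2 + (of_int b - of_int j / 3)\<^sup>2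
       + (of_int (j - a - b) - of_int j / 3)\<^sup>2) * \<tau> / 2))"

lemma A2_coset_theta_summable:
  assumes "Im \<tau> > 0"
  shows "(\<lambda>(a, b). norm (e2pi (((of_int a - of_int j / 3)\<^sup>2 + (of_int b - of_int j / 3)\<^sup>2
       + (of_int (j - a - b) - of_int j / 3)\<^sup>2) * \<tau> / 2))) summable_on (UNIV :: (int \<times> int) set)"
proof -
  let ?c = "- (real_of_int j / 3)"
  define M where "M = (\<lambda>p. norm (case p of (a, b) \<Rightarrow> theta_term ?c \<tau> 0 a * theta_term ?c \<tau> 0 b))"
  have M: "M summable_on UNIV \<times> UNIV"
    unfolding M_def by (intro has_sum_Times_mult theta_term_abs_summable assms)
  define h where "h = (\<lambda>(a, b). e2pi (((of_int a - of_int j / 3)\<^sup>2 + (of_int b - of_int j / 3)\<^sup>2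
       + (of_int (j - a - b) - of_int j / 3)\<^sup>2) * \<tau> / 2))"
  have "(\<lambda>p. norm (h p)) summable_on UNIV"
  proof (rule Infinite_Sum.abs_summable_on_comparison_test'[of M])
    fix p :: "int \<times> int"
    obtain a b where p: "p = (a, b)" by force
    let ?d = "\<lambda>x. (real_of_int x - real_of_int j / 3)\<^sup>2"
    have e: "norm (e2pi (of_real (D / 2) * \<tau>)) = exp (- pi * D * Im \<tau>)" for D :: real
      unfolding norm_e2pi by simp
    have "norm (h p) = norm (e2pi (of_real ((?d a + ?d b + ?d (j - a - b)) / 2) * \<tau>))"
      by (simp add: h_def p)
    also have "\<dots> = exp (- pi * (?d a + ?d b + ?d (j - a - b)) * Im \<tau>)"
      by (rule e)
    also have "\<dots> \<le> exp (- pi * (?d a + ?d b) * Im \<tau>)"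
      using assms by (simp add: mult_left_mono)
    also have "\<dots> = M p"
      by (simp add: M_def p norm_mult norm_theta_term algebra_simps flip: exp_add)
    finally show "norm (h p) \<le> M p" .
  qed (use M in simp)
  then show ?thesis by (simp add: h_def case_prod_unfold)
qed

text \<open>Write \<open>k \<in> \<int>\<^sup>3\<close> with coordinate sum \<open>3 m + j\<close>, where \<open>j \<in> {0, 1, 2}\<close>, as
  \<open>k = m (1,1,1) + l\<close>. The component along \<open>(1,1,1)\<close> has coordinates \<open>m + j/3\<close>, and the orthogonal
  component \<open>l - (j/3, j/3, j/3)\<close> runs over a coset of \<open>A\<^sub>2\<close>, independently of \<open>m\<close>.\<close>
lemma theta_cubed:
  assumes "Im \<tau> > 0"
  shows "theta r \<tau> u ^ 3
    = A2_coset_theta 0 \<tau> * theta r (3 * \<tau>) (3 * u)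
      + A2_coset_theta 1 \<tau> * theta (r + 1 / 3) (3 * \<tau>) (3 * u)
      + A2_coset_theta 2 \<tau> * theta (r + 2 / 3) (3 * \<tau>) (3 * u)"
proof -
  have y3: "Im (3 * \<tau>) > 0" using assms by simp
  let ?t = "theta_term r \<tau> u"
  define F where "F = (\<lambda>(k, l). ?t k * (case l of (l, m) \<Rightarrow> ?t l * ?t m))"
  define P where "P = (\<lambda>j. theta (r + of_int j / 3) (3 * \<tau>) (3 * u) * A2_coset_theta j \<tau>)"
  note abs = theta_term_abs_summable[OF assms, of r u]
  define g :: "int \<times> int \<times> int \<times> int \<Rightarrow> int \<times> int \<times> int"
    where "g = (\<lambda>(j, m, a, b). (m + a, m + b, m + j - a - b))"
  define g' :: "int \<times> int \<times> int \<Rightarrow> int \<times> int \<times> int \<times> int"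
    where "g' = (\<lambda>(k, l, m). let s = k + l + m in (s mod 3, s div 3, k - s div 3, l - s div 3))"
  have "bij_betw g ({0, 1, 2} \<times> UNIV) (UNIV \<times> UNIV)"
  proof (rule bij_betw_byWitness[where f' = g'])
    have "g' (g (j, m, a, b)) = (j, m, a, b)" if "j \<in> {0, 1, 2}" for j m a b
    proof -
      have "(m + a) + (m + b) + (m + j - a - b) = j + 3 * m" by simp
      moreover have "(j + 3 * m) mod 3 = j" "(j + 3 * m) div 3 = m" using that by auto
      ultimately show ?thesis unfolding g_def g'_def Let_def prod.case by simp
    qed
    then show "\<forall>x\<in>{0, 1, 2} \<times> UNIV. g' (g x) = x" by auto
    have "g (g' (k, l, m)) = (k, l, m)" for k l m
      using div_mult_mod_eq[of "k + l + m" 3] unfolding g_def g'_def Let_def prod.case prod.inject by linarith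
    then show "\<forall>y\<in>UNIV \<times> UNIV. g (g' y) = y" by auto
    have "s mod 3 \<in> {0, 1, 2}" for s :: int by auto
    then show "g' ` (UNIV \<times> UNIV) \<subseteq> {0, 1, 2} \<times> UNIV"
      unfolding g'_def Let_def by (auto simp del: insert_iff)
  qed auto
  note reindex = has_sum_reindex_bij_betw[OF this, of F]
  have inner: "((\<lambda>(l, m). ?t l * ?t m) has_sum theta r \<tau> u * theta r \<tau> u) UNIV"
      "(\<lambda>p. norm (case p of (l, m) \<Rightarrow> ?t l * ?t m)) summable_on UNIV"
    using has_sum_Times_mult[OF abs abs] by (simp_all add: theta_def)
  have "(F has_sum theta r \<tau> u ^ 3) (UNIV \<times> UNIV)"
    using has_sum_Times_mult(1)[OF abs inner(2)]
    by (simp add: F_def infsumI[OF inner(1)] power3_eq_cube mult.assoc flip: theta_def)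
  also have "?this \<longleftrightarrow> ((\<lambda>(j, m, a, b). F (m + a, m + b, m + j - a - b)) has_sum theta r \<tau> u ^ 3)
      ({0, 1, 2} \<times> UNIV)"
    unfolding reindex[symmetric] g_def by (simp only: case_prod_unfold)
  finally have total: "((\<lambda>(j, m, a, b). F (m + a, m + b, m + j - a - b)) has_sum theta r \<tau> u ^ 3)
      ({0, 1, 2} \<times> UNIV)" .
  have part: "((\<lambda>(m, a, b). F (m + a, m + b, m + j - a - b)) has_sum P j) UNIV" for j :: int
  proof -
    define h where "h = (\<lambda>(a::int, b::int). e2pi (((of_int a - of_int j / 3)\<^sup>2 + (of_int b - of_int j / 3)\<^sup>2
       + (of_int (j - a - b) - of_int j / 3)\<^sup>2) * \<tau> / 2))"
    have "(\<lambda>p. norm (h p)) summable_on UNIV"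
      using A2_coset_theta_summable[OF assms, of j] by (simp add: h_def case_prod_unfold)
    then have "((\<lambda>(m, l). theta_term (r + of_int j / 3) (3 * \<tau>) (3 * u) m * h l) has_sum P j) (UNIV \<times> UNIV)"
      unfolding P_def theta_def A2_coset_theta_def h_def[symmetric]
      by (intro has_sum_Times_mult theta_term_abs_summable y3)
    moreover have "F (m + a, m + b, m + j - a - b)
        = theta_term (r + of_int j / 3) (3 * \<tau>) (3 * u) m * h (a, b)" for m a b
    proof -
      define \<mu> \<alpha> \<beta> :: complex where "\<mu> = of_int m + of_real (r + of_int j / 3)"
        and "\<alpha> = of_int a - of_int j / 3" and "\<beta> = of_int b - of_int j / 3"
      have *: "of_int (m + a) + of_real r = \<mu> + \<alpha>" "of_int (m + b) + of_real r = \<mu> + \<beta>"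
        "of_int (m + j - a - b) + of_real r = \<mu> - \<alpha> - \<beta>"
        "of_int (j - a - b) - of_int j / 3 = - \<alpha> - \<beta>"
        by (simp_all add: \<mu>_def \<alpha>_def \<beta>_def field_simps)
      show ?thesis
        unfolding F_def theta_term_def prod.case e2pi_add[symmetric] h_def *
          \<mu>_def[symmetric] \<alpha>_def[symmetric] \<beta>_def[symmetric]
        by (rule arg_cong[of _ _ e2pi]) (simp add: field_simps power2_eq_square)
    qed
    ultimately show ?thesis by (simp add: case_prod_unfold)
  qed
  have "(P has_sum theta r \<tau> u ^ 3) {0, 1, 2}"
    by (rule has_sum_SigmaD[OF total]) (use part in auto)
  moreover have "(P has_sum (\<Sum>j\<in>{0,1,2}. P j)) {0, 1, 2}"
    by (rule has_sum_finite) auto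
  ultimately have "theta r \<tau> u ^ 3 = (\<Sum>j\<in>{0,1,2}. P j)"
    by (rule has_sum_unique)
  then show ?thesis by (simp add: P_def)
qed

text \<open>The two nontrivial cosets are negatives of each other.\<close>
lemma A2_coset_theta_2: "A2_coset_theta 2 \<tau> = A2_coset_theta 1 \<tau>"
  unfolding A2_coset_theta_def
proof (rule infsum_reindex_bij_witness[of _ "\<lambda>(a, b). (1 - a, 1 - b)" "\<lambda>(a, b). (1 - a, 1 - b)"], goal_cases)
  case (5 p)
  obtain a b where p: "p = (a, b)" by force
  have sq: "(of_int (1 - a) - of_int 1 / 3)\<^sup>2 = (of_int a - of_int 2 / 3 :: complex)\<^sup>2" for a
    using power2_minus[of "of_int a - of_int 2 / 3 :: complex"] by simp
  have "(of_int (1 - (1 - a) - (1 - b)) - of_int 1 / 3)\<^sup>2 = (of_int (2 - a - b) - of_int 2 / 3 :: complex)\<^sup>2"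
    using sq[of "2 - a - b"] by (simp add: algebra_simps)
  then show ?case unfolding p prod.case sq by simp
qed auto

lemma Re_omega3: "Re omega3 = - 1 / 2" and Im_omega3: "Im omega3 = sqrt 3 / 2"
proof -
  have "omega3 = cis (2 * pi / 3)"
    by (simp add: omega3_def cis_conv_exp mult_ac)
  then show "Re omega3 = - 1 / 2" "Im omega3 = sqrt 3 / 2"
    by (metis cis.sel(1) cos_120, metis cis.sel(2) sin_120)
qed

text \<open>In the coordinates \<open>(a, b, - a - b)\<close> half the squared length on \<open>A\<^sub>2\<close> is
  \<open>a\<^sup>2 + a b + b\<^sup>2\<close>, the norm of \<open>a - b \<omega>\<close>.\<close>
lemma Theta3_eq_A2_coset_theta: "Theta3 (2 * \<tau>) = A2_coset_theta 0 \<tau>"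
proof -
  define f where "f = (\<lambda>(a, b). of_int a - of_int b * omega3)"
  have O3: "O3 = range f"
  proof -
    have 1: "of_int a + of_int b * omega3 = f (a, - b)" for a b :: int by (simp add: f_def)
    have 2: "f p = of_int (fst p) + of_int (- snd p) * omega3" for p by (simp add: f_def case_prod_unfold)
    show ?thesis
    proof (intro equalityI subsetI)
      fix x assume "x \<in> O3"
      then obtain a b :: int where "x = of_int a + of_int b * omega3" unfolding O3_eq by blast
      then show "x \<in> range f" unfolding 1 by (rule range_eqI)
    next
      fix x assume "x \<in> range f"
      then obtain p where "x = f p" by blast
      then show "x \<in> O3" unfolding O3_eq 2 by blast
    qed
  qed
  have inj: "inj f"
  proof (rule injI, clarsimp simp: f_def)
    fix a b c d :: int
    assume *: "of_int a - of_int b * omega3 = of_int c - of_int d * omega3"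
    from arg_cong[OF *, of Im] have "b = d" by (simp add: Im_omega3)
    then show "a = c \<and> b = d" using * by simp
  qed
  have "Theta3 (2 * \<tau>) = (\<Sum>\<^sub>\<infinity>p. e2pi (of_real (O3_norm (f p) / 2) * (2 * \<tau>)))"
    unfolding Theta3_def O3 by (subst infsum_reindex[OF inj]) (simp add: o_def)
  also have "\<dots> = A2_coset_theta 0 \<tau>"
    unfolding A2_coset_theta_def
  proof (intro infsum_cong, clarify)
    fix a b :: int
    have "O3_norm (f (a, b)) = of_int a ^ 2 + of_int a * of_int b + of_int b ^ 2"
      unfolding O3_norm_def cmod_power2
      by (simp add: f_def Re_omega3 Im_omega3 power2_eq_square field_simps)
    then show "e2pi (of_real (O3_norm (f (a, b)) / 2) * (2 * \<tau>)) =
        e2pi (((of_int a - of_int 0 / 3)\<^sup>2 + (of_int b - of_int 0 / 3)\<^sup>2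
          + (of_int (0 - a - b) - of_int 0 / 3)\<^sup>2) * \<tau> / 2)"
      by (intro arg_cong[of _ _ e2pi]) (simp add: power2_eq_square field_simps)
  qed
  finally show ?thesis .
qed

section \<open>The Jacobi triple product\<close>

lemma e2pi_power: "e2pi x ^ k = e2pi (of_nat k * x)"
  by (simp add: e2pi_def exp_of_nat_mult[symmetric] mult_ac)

lemma norm_e2pi_less_1: "Im \<tau> > 0 \<Longrightarrow> norm (e2pi \<tau>) < 1"
  by (simp add: norm_e2pi)

text \<open>The \<open>q\<close>-Pochhammer symbol \<open>(q; q)\<^sub>m\<close>.\<close>
definition qpoch :: "complex \<Rightarrow> nat \<Rightarrow> complex" where
  "qpoch q m = (\<Prod>k<m. 1 - q ^ Suc k)"

lemma qpoch_Suc: "qpoch q (Suc m) = qpoch q m * (1 - q ^ Suc m)"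
  by (simp add: qpoch_def)

lemma power_neq_1: "norm (q :: complex) < 1 \<Longrightarrow> q ^ Suc k \<noteq> 1"
  by (metis norm_one norm_power power_Suc_less_one norm_ge_zero power_less_one_iff less_irrefl zero_less_Suc)

lemma qpoch_nonzero: "norm q < 1 \<Longrightarrow> qpoch q m \<noteq> 0"
  unfolding qpoch_def using power_neq_1[of q] by (auto simp del: power_Suc)

definition qbinomial :: "complex \<Rightarrow> nat \<Rightarrow> nat \<Rightarrow> complex" where
  "qbinomial q M j = (if j \<le> M then qpoch q M / (qpoch q j * qpoch q (M - j)) else 0)"

lemma qbinomial_Suc_Suc:
  assumes "norm q < 1" "j \<le> M"
  shows "qbinomial q (Suc M) (Suc j) = qbinomial q M (Suc j) + q ^ (M - j) * qbinomial q M j"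
proof (cases "j = M")
  case True
  then show ?thesis
    using qpoch_nonzero[OF assms(1)] by (simp add: qbinomial_def)
next
  case False
  define d where "d = M - Suc j"
  have M: "M = Suc (j + d)" using False assms(2) by (simp add: d_def)
  have [simp]: "qpoch q m \<noteq> 0" for m using qpoch_nonzero[OF assms(1)] .
  have nz: "1 - q ^ Suc m \<noteq> 0" for m using power_neq_1[OF assms(1)] by (metis eq_iff_diff_eq_0)
  have 1: "qpoch q (Suc M) = qpoch q M * ((1 - q ^ Suc d) + q ^ Suc d * (1 - q ^ Suc j))"
    by (simp add: qpoch_Suc M power_add algebra_simps)
  have 2: "qbinomial q (Suc M) (Suc j) = qpoch q M * ((1 - q ^ Suc d) + q ^ Suc d * (1 - q ^ Suc j))
      / ((qpoch q j * (1 - q ^ Suc j)) * (qpoch q d * (1 - q ^ Suc d)))"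
    unfolding 1[symmetric] by (simp add: qbinomial_def M qpoch_Suc)
  have 3: "qbinomial q M (Suc j) = qpoch q M / ((qpoch q j * (1 - q ^ Suc j)) * qpoch q d)"
    by (simp add: qbinomial_def M qpoch_Suc)
  have 4: "qbinomial q M j = qpoch q M / (qpoch q j * (qpoch q d * (1 - q ^ Suc d)))"
    by (simp add: qbinomial_def M qpoch_Suc Suc_diff_le)
  have 5: "M - j = Suc d" by (simp add: M)
  have gen: "F * (X + x * Y) / ((a * Y) * (b * X)) = F / ((a * Y) * b) + x * (F / (a * (b * X)))"
    if "X \<noteq> 0" "Y \<noteq> 0" "a \<noteq> 0" "b \<noteq> 0" for F x X Y a b :: complex
    using that by (simp add: field_simps)
  show ?thesis unfolding 2 3 4 5 by (rule gen) (use nz in auto)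
qed

theorem q_binomial_theorem:
  assumes "norm q < 1"
  shows "(\<Prod>k<M. 1 + y * q ^ k) = (\<Sum>j\<le>M. qbinomial q M j * q ^ (j choose 2) * y ^ j)"
proof (induction M)
  case 0
  have "(0 :: nat) choose 2 = 0" by (rule binomial_eq_0) simp
  then show ?case by (simp add: qbinomial_def qpoch_def binomial_eq_0)
next
  case (Suc M)
  define t where "t = (\<lambda>j. qbinomial q M j * q ^ (j choose 2) * y ^ j)"
  have "(\<Sum>j\<le>M. t j) = (\<Sum>j\<le>Suc M. t j)" by (simp add: t_def qbinomial_def)
  also have "\<dots> = t 0 + (\<Sum>j\<le>M. t (Suc j))" by (rule sum.atMost_Suc_shift)
  finally have S: "(\<Sum>j\<le>M. t j) = t 0 + (\<Sum>j\<le>M. t (Suc j))" .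
  have "(\<Prod>k<Suc M. 1 + y * q ^ k) = (\<Sum>j\<le>M. t j) + (\<Sum>j\<le>M. t j) * (y * q ^ M)"
    using Suc by (simp add: t_def ring_distribs)
  also have "\<dots> = t 0 + (\<Sum>j\<le>M. t (Suc j) + t j * (y * q ^ M))"
    by (subst (1) S) (simp add: sum.distrib sum_distrib_right)
  also have "(\<Sum>j\<le>M. t (Suc j) + t j * (y * q ^ M))
      = (\<Sum>j\<le>M. qbinomial q (Suc M) (Suc j) * q ^ (Suc j choose 2) * y ^ Suc j)"
  proof (rule sum.cong)
    fix j assume "j \<in> {..M}"
    then have j: "j \<le> M" by simp
    have ch: "Suc j choose 2 = (j choose 2) + j" by (simp add: numeral_2_eq_2)
    have "q ^ M = q ^ (M - j) * q ^ j" using j by (simp flip: power_add)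
    then show "t (Suc j) + t j * (y * q ^ M)
        = qbinomial q (Suc M) (Suc j) * q ^ (Suc j choose 2) * y ^ Suc j"
      unfolding qbinomial_Suc_Suc[OF assms j] t_def ch by (simp add: power_add algebra_simps)
  qed simp
  also have "t 0 = qbinomial q (Suc M) 0 * q ^ (0 choose 2) * y ^ 0"
    using qpoch_nonzero[OF assms] by (simp add: t_def qbinomial_def qpoch_def[of _ 0] binomial_eq_0)
  finally show ?case by (simp add: sum.atMost_Suc_shift del: sum.atMost_Suc)
qed

lemma prod_lessThan_add:
  fixes f :: "nat \<Rightarrow> complex"
  shows "(\<Prod>k<m + n. f k) = (\<Prod>k<m. f k) * (\<Prod>k<n. f (m + k))"
  by (induction n) (simp_all add: mult_ac)

text \<open>Take the \<open>q\<close>-binomial theorem with \<open>M = 2 N\<close> factors and \<open>y = e(v) q\<^bsup>1/2 - N\<^esup>\<close>. The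
  exponents of \<open>q\<close> in the factors are then symmetric about \<open>0\<close>; pulling the monomial out of each of the
  \<open>N\<close> factors with a negative exponent turns \<open>e(v)\<close> into \<open>e(- v)\<close> there, and the product of these
  monomials centres the sum at \<open>j = N\<close>.\<close>
lemma finite_Jacobi_triple_product:
  assumes "Im \<tau> > 0"
  shows "(\<Prod>k<N. (1 + e2pi (v + (of_nat k + 1/2) * \<tau>)) * (1 + e2pi (- v + (of_nat k + 1/2) * \<tau>)))
    = (\<Sum>n\<in>{- int N..int N}. qbinomial (e2pi \<tau>) (2 * N) (nat (int N + n))
         * e2pi (of_int n ^ 2 * \<tau> / 2 + of_int n * v))"
proof -
  define y where "y = e2pi (v - (of_nat N - 1/2) * \<tau>)"
  define f where "f = (\<lambda>k. 1 + y * e2pi \<tau> ^ k)"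
  define w where "w = e2pi (of_nat N * v - of_nat N ^ 2 * \<tau> / 2)"
  have yq: "y * e2pi \<tau> ^ k = e2pi (v + (of_nat k - of_nat N + 1/2) * \<tau>)" for k
    unfolding y_def e2pi_power e2pi_add[symmetric] by (rule arg_cong[of _ _ e2pi]) (simp add: algebra_simps)
  have "(\<Prod>k<2 * N. f k) = (\<Prod>k<N. f (N - Suc k)) * (\<Prod>k<N. f (N + k))"
    using prod_lessThan_add[of f N N] by (simp add: prod.nat_diff_reindex mult_2)
  also have "(\<Prod>k<N. f (N - Suc k)) = (\<Prod>k<N. e2pi (v - (of_nat k + 1/2) * \<tau>) * (1 + e2pi (- v + (of_nat k + 1/2) * \<tau>)))"
  proof (rule prod.cong)
    fix k assume "k \<in> {..<N}"
    then have k: "(of_nat (N - Suc k) :: complex) = of_nat N - of_nat k - 1" by (simp add: of_nat_diff)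
    have "e2pi (v - (of_nat k + 1/2) * \<tau>) * e2pi (- v + (of_nat k + 1/2) * \<tau>) = 1"
      unfolding e2pi_add[symmetric] by (simp add: e2pi_def)
    moreover have "f (N - Suc k) = 1 + e2pi (v - (of_nat k + 1/2) * \<tau>)"
      unfolding f_def yq k by (simp add: algebra_simps)
    ultimately show "f (N - Suc k) = e2pi (v - (of_nat k + 1/2) * \<tau>) * (1 + e2pi (- v + (of_nat k + 1/2) * \<tau>))"
      by (simp add: ring_distribs)
  qed simp
  also have "\<dots> = (\<Prod>k<N. e2pi (v - (of_nat k + 1/2) * \<tau>)) * (\<Prod>k<N. 1 + e2pi (- v + (of_nat k + 1/2) * \<tau>))"
    by (rule prod.distrib)
  also have "(\<Prod>k<N. e2pi (v - (of_nat k + 1/2) * \<tau>)) = w"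
    unfolding w_def
  proof (induction N)
    case (Suc N)
    then show ?case
      unfolding prod.lessThan_Suc e2pi_add[symmetric] Suc
      by (intro arg_cong[of _ _ e2pi]) (simp add: power2_eq_square field_simps)
  qed (simp add: e2pi_def)
  also have "(\<Prod>k<N. f (N + k)) = (\<Prod>k<N. 1 + e2pi (v + (of_nat k + 1/2) * \<tau>))"
    unfolding f_def yq by simp
  finally have lhs: "(\<Prod>k<2 * N. f k) = w *
      (\<Prod>k<N. (1 + e2pi (v + (of_nat k + 1/2) * \<tau>)) * (1 + e2pi (- v + (of_nat k + 1/2) * \<tau>)))"
    by (simp add: prod.distrib mult_ac)
  have "(\<Prod>k<2 * N. f k) = (\<Sum>j\<le>2 * N. qbinomial (e2pi \<tau>) (2 * N) j * e2pi \<tau> ^ (j choose 2) * y ^ j)"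
    unfolding f_def by (rule q_binomial_theorem[OF norm_e2pi_less_1[OF assms]])
  also have "\<dots> = (\<Sum>n\<in>{- int N..int N}. w * (qbinomial (e2pi \<tau>) (2 * N) (nat (int N + n))
         * e2pi (of_int n ^ 2 * \<tau> / 2 + of_int n * v)))"
  proof (rule sum.reindex_bij_witness[of _ "\<lambda>n. nat (int N + n)" "\<lambda>j. int j - int N"])
    fix j assume "j \<in> {..2 * N}"
    have ch: "(of_nat (j choose 2) :: complex) = of_nat j * (of_nat j - 1) / 2"
    proof -
      have "even (j * (j - 1))" by (cases "even j") auto
      then have "2 * (j choose 2) = j * (j - 1)" by (simp add: choose_two)
      then have "2 * (of_nat (j choose 2) :: complex) = of_nat (j * (j - 1))"
        by (metis of_nat_mult of_nat_numeral)
      then show ?thesis by (cases j) (simp_all add: field_simps)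
    qed
    have "e2pi \<tau> ^ (j choose 2) * y ^ j
        = w * e2pi (of_int (int j - int N) ^ 2 * \<tau> / 2 + of_int (int j - int N) * v)"
      unfolding y_def w_def e2pi_power ch e2pi_add[symmetric]
      by (intro arg_cong[of _ _ e2pi]) (simp add: power2_eq_square field_simps)
    then show "w * (qbinomial (e2pi \<tau>) (2 * N) (nat (int N + (int j - int N)))
         * e2pi (of_int (int j - int N) ^ 2 * \<tau> / 2 + of_int (int j - int N) * v))
      = qbinomial (e2pi \<tau>) (2 * N) j * e2pi \<tau> ^ (j choose 2) * y ^ j"
      by (simp add: mult_ac)
  qed auto
  also have "\<dots> = w * (\<Sum>n\<in>{- int N..int N}. qbinomial (e2pi \<tau>) (2 * N) (nat (int N + n))
         * e2pi (of_int n ^ 2 * \<tau> / 2 + of_int n * v))"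
    by (rule sum_distrib_left[symmetric])
  finally show ?thesis
    using lhs by (simp add: w_def)
qed

lemma prod_one_plus_tendsto:
  fixes a :: "nat \<Rightarrow> complex"
  assumes "summable (\<lambda>k. norm (a k))"
  shows "\<exists>L. (\<lambda>N. \<Prod>k<N. 1 + a k) \<longlonglongrightarrow> L \<and> ((\<forall>k. 1 + a k \<noteq> 0) \<longrightarrow> L \<noteq> 0)"
proof -
  have c: "convergent_prod (\<lambda>k. 1 + a k)"
    using assms by (intro abs_convergent_prod_imp_convergent_prod) (simp add: abs_convergent_prod_conv_summable)
  have "(\<lambda>N. \<Prod>k<Suc N. 1 + a k) \<longlonglongrightarrow> prodinf (\<lambda>k. 1 + a k)"
    using convergent_prod_LIMSEQ[OF c] by (simp add: lessThan_Suc_atMost)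
  then have "(\<lambda>N. \<Prod>k<N. 1 + a k) \<longlonglongrightarrow> prodinf (\<lambda>k. 1 + a k)"
    by (rule LIMSEQ_imp_Suc)
  then show ?thesis using prodinf_nonzero[OF c] by blast
qed

text \<open>The Euler function \<open>(q; q)\<^sub>\<infinity>\<close> at \<open>q = e(\<tau>)\<close>.\<close>
definition euler_prod :: "complex \<Rightarrow> complex" where
  "euler_prod \<tau> = lim (qpoch (e2pi \<tau>))"

lemma summable_norm_geometric_e2pi:
  assumes "Im \<tau> > 0"
  shows "summable (\<lambda>k. norm (c * e2pi \<tau> ^ k))"
  using norm_e2pi_less_1[OF assms] by (simp add: norm_mult norm_power summable_geometric summable_mult)

lemma qpoch_tendsto:
  assumes "Im \<tau> > 0"
  shows "qpoch (e2pi \<tau>) \<longlonglongrightarrow> euler_prod \<tau>" and "euler_prod \<tau> \<noteq> 0"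
proof -
  obtain L where L: "(\<lambda>N. \<Prod>k<N. 1 + (- e2pi \<tau>) * e2pi \<tau> ^ k) \<longlonglongrightarrow> L"
    "(\<forall>k. 1 + (- e2pi \<tau>) * e2pi \<tau> ^ k \<noteq> 0) \<longrightarrow> L \<noteq> 0"
    using prod_one_plus_tendsto[OF summable_norm_geometric_e2pi[OF assms, of "- e2pi \<tau>"]] by blast
  have q: "qpoch (e2pi \<tau>) \<longlonglongrightarrow> L"
    using L(1) by (simp add: qpoch_def[abs_def])
  have "1 + (- e2pi \<tau>) * e2pi \<tau> ^ k \<noteq> 0" for k
    using power_neq_1[OF norm_e2pi_less_1[OF assms], of k] by simp
  then have "L \<noteq> 0" using L(2) by blast
  moreover have "euler_prod \<tau> = L" unfolding euler_prod_def using q by (rule limI)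
  ultimately show "qpoch (e2pi \<tau>) \<longlonglongrightarrow> euler_prod \<tau>" "euler_prod \<tau> \<noteq> 0"
    using q by auto
qed

text \<open>The central \<open>q\<close>-binomial coefficients are uniformly bounded, since \<open>(q; q)\<^sub>m\<close> converges to a
  nonzero limit, and each tends to \<open>1 / (q; q)\<^sub>\<infinity>\<close>. Tannery's theorem applies.\<close>
lemma qbinomial_sum_tendsto:
  assumes "Im \<tau> > 0" and g: "(\<lambda>n. norm (g n)) summable_on UNIV"
  shows "(\<lambda>N. \<Sum>n\<in>{- int N..int N}. qbinomial (e2pi \<tau>) (2 * N) (nat (int N + n)) * g n)
    \<longlonglongrightarrow> (\<Sum>\<^sub>\<infinity>n. g n) / euler_prod \<tau>"
proof -
  let ?q = "e2pi \<tau>" and ?L = "euler_prod \<tau>"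
  note Q = qpoch_tendsto[OF assms(1)]
  have nz: "qpoch ?q m \<noteq> 0" for m by (rule qpoch_nonzero[OF norm_e2pi_less_1[OF assms(1)]])
  have "Bseq (qpoch ?q)" using Q(1) by (intro convergent_imp_Bseq convergentI)
  then obtain K where K: "K > 0" "\<And>m. norm (qpoch ?q m) \<le> K" by (auto simp: Bseq_def)
  have "Bseq (\<lambda>m. inverse (qpoch ?q m))"
    by (intro convergent_imp_Bseq convergentI) (rule tendsto_inverse[OF Q])
  then obtain K' where K': "K' > 0" "\<And>m. norm (inverse (qpoch ?q m)) \<le> K'" by (auto simp: Bseq_def)
  define c where "c = (\<lambda>n N. if n \<in> {- int N..int N} then qbinomial ?q (2 * N) (nat (int N + n)) else 0)"
  have c_le: "norm (c n N) \<le> K * (K' * K')" for n N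
  proof (cases "n \<in> {- int N..int N}")
    case True
    then have "nat (int N + n) \<le> 2 * N" by auto
    with True have "norm (c n N) = norm (qpoch ?q (2 * N)) * (norm (inverse (qpoch ?q (nat (int N + n))))
        * norm (inverse (qpoch ?q (2 * N - nat (int N + n)))))"
      by (simp add: c_def qbinomial_def norm_mult norm_divide divide_simps norm_inverse)
    also have "\<dots> \<le> K * (K' * K')"
      using K K' by (intro mult_mono mult_nonneg_nonneg) (auto intro: less_imp_le)
    finally show ?thesis .
  qed (use K K' in \<open>auto simp: c_def\<close>)
  have c_lim: "c n \<longlonglongrightarrow> 1 / ?L" for n
  proof -
    have top: "filterlim (\<lambda>N. nat (int N + m)) at_top sequentially" for m :: int
      unfolding filterlim_at_top eventually_sequentially
    proof
      fix Z show "\<exists>N. \<forall>M\<ge>N. Z \<le> nat (int M + m)"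
        by (rule exI[of _ "Z + nat \<bar>m\<bar>"]) auto
    qed
    have top2: "filterlim (\<lambda>N::nat. 2 * N) at_top sequentially"
      by (rule filterlim_subseq) (auto simp: strict_mono_def)
    have "(\<lambda>N. qpoch ?q (2 * N) / (qpoch ?q (nat (int N + n)) * qpoch ?q (nat (int N + - n))))
        \<longlonglongrightarrow> ?L / (?L * ?L)"
      using Q(2) by (intro tendsto_divide tendsto_mult filterlim_compose[OF Q(1)] top top2) auto
    moreover have "\<forall>\<^sub>F N in sequentially. qpoch ?q (2 * N) / (qpoch ?q (nat (int N + n)) * qpoch ?q (nat (int N + - n))) = c n N"
      unfolding eventually_sequentially
    proof (intro exI[of _ "nat \<bar>n\<bar>"] allI impI)
      fix N assume N: "nat \<bar>n\<bar> \<le> N"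
      then have "2 * N - nat (int N + n) = nat (int N + - n)" "n \<in> {- int N..int N}" "nat (int N + n) \<le> 2 * N"
        by auto
      then show "qpoch ?q (2 * N) / (qpoch ?q (nat (int N + n)) * qpoch ?q (nat (int N + - n))) = c n N"
        by (simp add: c_def qbinomial_def)
    qed
    ultimately have "c n \<longlonglongrightarrow> ?L / (?L * ?L)" by (rule Lim_transform_eventually)
    then show ?thesis using Q(2) by simp
  qed
  have "(\<lambda>N. \<Sum>\<^sub>\<infinity>n. c n N * g n) \<longlonglongrightarrow> (\<Sum>\<^sub>\<infinity>n. 1 / ?L * g n)"
  proof (rule tendsto_infsum_dominated)
    show "(\<lambda>n. K * (K' * K') * norm (g n)) summable_on UNIV"
      by (rule summable_on_cmult_right[OF g])
    show "norm (c n N * g n) \<le> K * (K' * K') * norm (g n)" for n N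
      using c_le by (simp add: norm_mult mult_right_mono)
    show "((\<lambda>N. c n N * g n) \<longlongrightarrow> 1 / ?L * g n) sequentially" for n
      by (intro tendsto_intros c_lim)
  qed auto
  moreover have "(\<Sum>\<^sub>\<infinity>n. c n N * g n)
      = (\<Sum>n\<in>{- int N..int N}. qbinomial ?q (2 * N) (nat (int N + n)) * g n)" for N
  proof -
    have "(\<Sum>\<^sub>\<infinity>n. c n N * g n) = (\<Sum>\<^sub>\<infinity>n\<in>{- int N..int N}. qbinomial ?q (2 * N) (nat (int N + n)) * g n)"
      by (rule infsum_cong_neutral) (auto simp: c_def)
    then show ?thesis by simp
  qed
  moreover have "(\<Sum>\<^sub>\<infinity>n. 1 / ?L * g n) = (\<Sum>\<^sub>\<infinity>n. g n) / ?L"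
    unfolding infsum_cmult_right' by simp
  ultimately show ?thesis by simp
qed

text \<open>A truncation of the product side of the triple product at \<open>v = u + r \<tau>\<close>. The prefactor is
  the part of the exponent in \<open>theta_term r \<tau> u n\<close> that is independent of \<open>n\<close>.\<close>
definition theta_product :: "real \<Rightarrow> complex \<Rightarrow> nat \<Rightarrow> complex \<Rightarrow> complex" where
  "theta_product r \<tau> N u = e2pi (of_real r ^ 2 * \<tau> / 2 + of_real r * u)
     * (\<Prod>k<N. 1 + e2pi (u + (of_nat k + 1/2 + of_real r) * \<tau>))
     * (\<Prod>k<N. 1 + e2pi (- u + (of_nat k + 1/2 - of_real r) * \<tau>))"

lemma theta_product_eq_sum:
  assumes "Im \<tau> > 0"
  shows "theta_product r \<tau> N u = (\<Sum>n\<in>{- int N..int N}.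
    qbinomial (e2pi \<tau>) (2 * N) (nat (int N + n)) * theta_term r \<tau> u n)"
proof -
  define v where "v = u + of_real r * \<tau>"
  have 1: "u + (of_nat k + 1/2 + of_real r) * \<tau> = v + (of_nat k + 1/2) * \<tau>"
     "- u + (of_nat k + 1/2 - of_real r) * \<tau> = - v + (of_nat k + 1/2) * \<tau>" for k
    by (simp_all add: v_def algebra_simps)
  have 2: "theta_term r \<tau> u n = e2pi (of_real r ^ 2 * \<tau> / 2 + of_real r * u)
      * e2pi (of_int n ^ 2 * \<tau> / 2 + of_int n * v)" for n
    unfolding theta_term_def e2pi_add[symmetric] v_def
    by (rule arg_cong[of _ _ e2pi]) (simp add: power2_eq_square field_simps)
  show ?thesis
    unfolding theta_product_def 1 2 mult.assoc prod.distrib[symmetric] finite_Jacobi_triple_product[OF assms]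
    by (simp add: sum_distrib_left mult_ac)
qed

theorem theta_product_tendsto:
  assumes "Im \<tau> > 0"
  shows "(\<lambda>N. theta_product r \<tau> N u) \<longlonglongrightarrow> theta r \<tau> u / euler_prod \<tau>"
  unfolding theta_product_eq_sum[OF assms] theta_def
  by (rule qbinomial_sum_tendsto[OF assms theta_term_abs_summable[OF assms]])

text \<open>The truncated products are finite sums with the same central \<open>q\<close>-binomial weights, so the limit of
  their derivatives is again an instance of \<open>qbinomial_sum_tendsto\<close>, now for the differentiated series.\<close>
lemma deriv_theta_product_tendsto:
  assumes "Im \<tau> > 0"
  shows "(\<lambda>N. deriv (theta_product r \<tau> N) u) \<longlonglongrightarrow> deriv (theta r \<tau>) u / euler_prod \<tau>"
proof -
  define t' where "t' = (\<lambda>n. 2 * of_real pi * \<i> * (of_int n + of_real r) * theta_term r \<tau> u n)"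
  obtain D where D: "(theta r \<tau> has_field_derivative D) (at u)" "(t' has_sum D) UNIV"
    using theta_has_field_derivative[OF assms] unfolding t'_def by blast
  have "(\<lambda>n. norm (t' n)) summable_on UNIV"
    using has_sum_imp_summable[OF D(2)] by (simp add: summable_on_iff_abs_summable_on_complex)
  from qbinomial_sum_tendsto[OF assms this]
  have "(\<lambda>N. \<Sum>n\<in>{- int N..int N}. qbinomial (e2pi \<tau>) (2 * N) (nat (int N + n)) * t' n)
    \<longlonglongrightarrow> deriv (theta r \<tau>) u / euler_prod \<tau>"
    using infsumI[OF D(2)] DERIV_imp_deriv[OF D(1)] by simp
  moreover have "deriv (theta_product r \<tau> N) u
     = (\<Sum>n\<in>{- int N..int N}. qbinomial (e2pi \<tau>) (2 * N) (nat (int N + n)) * t' n)" for N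
  proof (rule DERIV_imp_deriv)
    have t: "((\<lambda>v. theta_term r \<tau> v n) has_field_derivative t' n) (at u)" for n
      unfolding theta_term_def e2pi_def t'_def by (rule derivative_eq_intros refl)+ simp
    have "theta_product r \<tau> N = (\<lambda>u. \<Sum>n\<in>{- int N..int N}.
        qbinomial (e2pi \<tau>) (2 * N) (nat (int N + n)) * theta_term r \<tau> u n)"
      by (rule ext) (rule theta_product_eq_sum[OF assms])
    then show "(theta_product r \<tau> N has_field_derivative (\<Sum>n\<in>{- int N..int N}.
        qbinomial (e2pi \<tau>) (2 * N) (nat (int N + n)) * t' n)) (at u)"
      by (simp only:) (intro DERIV_sum DERIV_cmult t)
  qed
  ultimately show ?thesis by simp
qed

section \<open>Nonvanishing and special values\<close>

lemma e2pi_sixth: "e2pi (1/6) = Complex (1/2) (sqrt 3 / 2)"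
  using e2pi_of_real[of "1/6"] by (simp add: complex_eq_iff cos_60 sin_60)

lemma e2pi_twelfth: "e2pi (1/12) = Complex (sqrt 3 / 2) (1/2)"
  using e2pi_of_real[of "1/12"] by (simp add: complex_eq_iff cos_30 sin_30)

lemma e2pi_fourth: "e2pi (1/4) = \<i>"
  using e2pi_of_real[of "1/4"] by (simp add: complex_eq_iff)

lemma e2pi_minus: "e2pi (- x) = inverse (e2pi x)"
  by (simp add: e2pi_def exp_minus)

lemma e2pi_minus_sixth: "e2pi (- (1/6)) = Complex (1/2) (- (sqrt 3 / 2))"
  using e2pi_of_real[of "- (1/6)"] by (simp add: complex_eq_iff cos_60 sin_60)

lemma theta_factor_nonzero:
  assumes "Im x > 0"
  shows "1 + e2pi x \<noteq> 0"
proof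
  assume "1 + e2pi x = 0"
  then have "e2pi x = - 1" by (simp add: add_eq_0_iff)
  then have "norm (e2pi x) = 1" by simp
  then show False using assms by (simp add: norm_e2pi)
qed

text \<open>For real \<open>u\<close> the \<open>k\<close>-th factors of the product have the form \<open>1 + e(x)\<close> with imaginary part
  of \<open>x\<close> equal to \<open>(k + 1/2 \<plusminus> r)\<close> times that of \<open>\<tau>\<close>. It is positive, so \<open>e(x)\<close> is not on the unit circle,
  except for the single factor \<open>1 + e(- u)\<close> when \<open>r = 1/2\<close>.\<close>
lemma theta_nonzero:
  assumes "Im \<tau> > 0" and "Im u = 0"
    and r: "\<bar>r\<bar> < 1/2 \<or> r = 1/2 \<and> e2pi u \<noteq> - 1"
  shows "theta r \<tau> u \<noteq> 0"
proof -
  have fac: "e2pi (c + (of_nat k + d) * \<tau>) = e2pi (c + d * \<tau>) * e2pi \<tau> ^ k" for c d :: complex and k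
    unfolding e2pi_power e2pi_add[symmetric] by (rule arg_cong[of _ _ e2pi]) (simp add: algebra_simps)
  note f1 = fac[of u _ "1/2 + of_real r"] and f2 = fac[of "- u" _ "1/2 - of_real r"]
  obtain A where A: "(\<lambda>N. \<Prod>k<N. 1 + e2pi (u + (of_nat k + (1/2 + of_real r)) * \<tau>)) \<longlonglongrightarrow> A"
    "(\<forall>k. 1 + e2pi (u + (of_nat k + (1/2 + of_real r)) * \<tau>) \<noteq> 0) \<longrightarrow> A \<noteq> 0"
    unfolding f1 using prod_one_plus_tendsto[OF summable_norm_geometric_e2pi[OF assms(1),
          of "e2pi (u + (1/2 + of_real r) * \<tau>)"]] by blast
  obtain B where B: "(\<lambda>N. \<Prod>k<N. 1 + e2pi (- u + (of_nat k + (1/2 - of_real r)) * \<tau>)) \<longlonglongrightarrow> B"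
    "(\<forall>k. 1 + e2pi (- u + (of_nat k + (1/2 - of_real r)) * \<tau>) \<noteq> 0) \<longrightarrow> B \<noteq> 0"
    unfolding f2 using prod_one_plus_tendsto[OF summable_norm_geometric_e2pi[OF assms(1),
          of "e2pi (- u + (1/2 - of_real r) * \<tau>)"]] by blast
  have Im: "Im (c + (of_nat k + (1/2 + of_real s)) * \<tau>) = (real k + (1/2 + s)) * Im \<tau>"
    if "Im c = 0" for c k s
    using that by simp
  have "1 + e2pi (u + (of_nat k + (1/2 + of_real r)) * \<tau>) \<noteq> 0" for k
    using assms by (intro theta_factor_nonzero) (subst Im, auto intro!: mult_pos_pos)
  then have A0: "A \<noteq> 0" using A(2) by simp
  have "1 + e2pi (- u + (of_nat k + (1/2 - of_real r)) * \<tau>) \<noteq> 0" for k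
  proof (cases "r = 1/2 \<and> k = 0")
    case True
    then have "e2pi u \<noteq> - 1" using r by auto
    moreover have "e2pi (- u) * e2pi u = 1" by (simp add: e2pi_def flip: exp_add)
    ultimately have "1 + e2pi (- u) \<noteq> 0"
      by (metis add_eq_0_iff minus_minus mult_minus1)
    moreover have "- u + (of_nat k + (1/2 - of_real r)) * \<tau> = - u"
      unfolding conjunct1[OF True] conjunct2[OF True] by simp
    ultimately show ?thesis by (simp only: not_False_eq_True)
  next
    case False
    then have "real k + (1/2 + - r) > 0" using r by (cases k) auto
    then show ?thesis
      using assms Im[of "- u" k "- r"] by (intro theta_factor_nonzero) simp
  qed
  then have B0: "B \<noteq> 0" using B(2) by simp
  have "(\<lambda>N. theta_product r \<tau> N u) \<longlonglongrightarrow> e2pi (of_real r ^ 2 * \<tau> / 2 + of_real r * u) * A * B"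
    using tendsto_mult[OF tendsto_mult[OF tendsto_const A(1)] B(1)]
    by (simp add: theta_product_def add_diff_eq add.assoc)
  with theta_product_tendsto[OF assms(1)]
  have "theta r \<tau> u / euler_prod \<tau> = e2pi (of_real r ^ 2 * \<tau> / 2 + of_real r * u) * A * B"
    by (rule LIMSEQ_unique)
  then show ?thesis using A0 B0 by auto
qed

text \<open>For \<open>r = 1/2\<close> the factor \<open>1 + e(- u)\<close>, the only one free of \<open>q\<close>, is split off.\<close>
lemma theta_product_half_Suc:
  "theta_product (1/2) \<tau> (Suc M) u = (1 + e2pi (- u)) * (e2pi (\<tau> / 8 + u / 2)
     * (\<Prod>k<Suc M. 1 + e2pi u * e2pi \<tau> ^ Suc k) * (\<Prod>k<M. 1 + e2pi (- u) * e2pi \<tau> ^ Suc k))"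
proof -
  have 1: "e2pi (u + (of_nat k + 1/2 + of_real (1/2)) * \<tau>) = e2pi u * e2pi \<tau> ^ Suc k" for k
    unfolding e2pi_power e2pi_add[symmetric] by (rule arg_cong[of _ _ e2pi]) (simp add: algebra_simps)
  have 2: "e2pi (- u + (of_nat k + 1/2 - of_real (1/2)) * \<tau>) = e2pi (- u) * e2pi \<tau> ^ k" for k
    unfolding e2pi_power e2pi_add[symmetric] by (rule arg_cong[of _ _ e2pi]) (simp add: algebra_simps)
  have 3: "of_real (1/2) ^ 2 * \<tau> / 2 + of_real (1/2) * u = \<tau> / 8 + u / 2"
    by (simp add: power2_eq_square)
  show ?thesis
    unfolding theta_product_def 1 2 3 prod.lessThan_Suc_shift[of "\<lambda>k. 1 + e2pi (- u) * e2pi \<tau> ^ k"]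
    by (simp add: mult_ac)
qed

text \<open>At \<open>u = 1/2\<close> only the derivative of the vanishing factor \<open>1 + e(- u)\<close> contributes, and each of
  the two remaining products is \<open>(q; q)\<^sub>m\<close> for some \<open>m\<close>, because \<open>e(\<plusminus>1/2) = -1\<close>. The third
  Euler factor is the one in \<open>theta_product_tendsto\<close>.\<close>
lemma deriv_theta_half_half:
  assumes "Im \<tau> > 0"
  shows "deriv (theta (1/2) \<tau>) (1/2) = - 2 * of_real pi * e2pi (\<tau> / 8) * euler_prod \<tau> ^ 3"
proof -
  note Q = qpoch_tendsto[OF assms]
  have "deriv (theta_product (1/2) \<tau> (Suc M)) (1/2)
      = - 2 * of_real pi * e2pi (\<tau> / 8) * (qpoch (e2pi \<tau>) (Suc M) * qpoch (e2pi \<tau>) M)" for M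
  proof -
    define R where "R = (\<lambda>u. e2pi (\<tau> / 8 + u / 2)
      * (\<Prod>k<Suc M. 1 + e2pi u * e2pi \<tau> ^ Suc k) * (\<Prod>k<M. 1 + e2pi (- u) * e2pi \<tau> ^ Suc k))"
    have "R holomorphic_on UNIV"
      unfolding R_def e2pi_def by (intro holomorphic_intros) auto
    then have "R field_differentiable at (1/2)" by (simp add: holomorphic_on_def)
    then obtain R' where R': "(R has_field_derivative R') (at (1/2))"
      by (auto simp: field_differentiable_def)
    have m: "e2pi (- (1/2)) = - 1" by (simp add: e2pi_minus e2pi_half)
    have "((\<lambda>u. 1 + e2pi (- u)) has_field_derivative - 2 * of_real pi * \<i> * e2pi (- (1/2))) (at (1/2))"
      unfolding e2pi_def by (rule derivative_eq_intros refl)+ simp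
    from DERIV_mult[OF this R']
    have "((\<lambda>u. (1 + e2pi (- u)) * R u) has_field_derivative 2 * of_real pi * \<i> * R (1/2)) (at (1/2))"
      by (simp add: m)
    moreover have "theta_product (1/2) \<tau> (Suc M) = (\<lambda>u. (1 + e2pi (- u)) * R u)"
      unfolding R_def by (rule ext) (rule theta_product_half_Suc)
    ultimately have "deriv (theta_product (1/2) \<tau> (Suc M)) (1/2) = 2 * of_real pi * \<i> * R (1/2)"
      by (simp add: DERIV_imp_deriv)
    moreover have "R (1/2) = \<i> * e2pi (\<tau> / 8) * (qpoch (e2pi \<tau>) (Suc M) * qpoch (e2pi \<tau>) M)"
      unfolding R_def m e2pi_half e2pi_add qpoch_def using e2pi_fourth by simp
    ultimately show ?thesis by simp
  qed
  moreover have "(\<lambda>M. - 2 * of_real pi * e2pi (\<tau> / 8) * (qpoch (e2pi \<tau>) (Suc M) * qpoch (e2pi \<tau>) M))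
      \<longlonglongrightarrow> - 2 * of_real pi * e2pi (\<tau> / 8) * (euler_prod \<tau> * euler_prod \<tau>)"
    by (intro tendsto_mult tendsto_const LIMSEQ_Suc Q)
  ultimately have "(\<lambda>M. deriv (theta_product (1/2) \<tau> (Suc M)) (1/2))
      \<longlonglongrightarrow> - 2 * of_real pi * e2pi (\<tau> / 8) * (euler_prod \<tau> * euler_prod \<tau>)"
    by simp
  from LIMSEQ_unique[OF LIMSEQ_Suc[OF deriv_theta_product_tendsto[OF assms]] this]
  show ?thesis using Q(2) by (simp add: divide_eq_eq power3_eq_cube mult_ac)
qed

text \<open>The three factors \<open>1 - y\<close>, \<open>1 + y e(1/6)\<close>, \<open>1 + y e(-1/6)\<close> of the triple product at
  \<open>y = q\<^sup>k\<close> multiply to \<open>1 - y\<^sup>3\<close>, since \<open>-e(1/6)\<close> and \<open>-e(-1/6)\<close> are the primitive cube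
  roots of unity. The factor \<open>1 + e(-1/6)\<close> free of \<open>q\<close> supplies \<open>sqrt 3\<close>.\<close>
lemma theta_half_sixth:
  assumes "Im \<tau> > 0"
  shows "theta (1/2) \<tau> (1/6) = of_real (sqrt 3) * e2pi (\<tau> / 8) * euler_prod (3 * \<tau>)"
proof -
  let ?q = "e2pi \<tau>"
  have y3: "Im (3 * \<tau>) > 0" using assms by simp
  define a where "a = (\<lambda>N. \<Prod>k<N. 1 + e2pi (1/6) * ?q ^ Suc k)"
  define b where "b = (\<lambda>N. \<Prod>k<N. 1 + e2pi (- (1/6)) * ?q ^ Suc k)"
  have conv: "\<exists>L. (\<lambda>N. \<Prod>k<N. 1 + c * ?q ^ Suc k) \<longlonglongrightarrow> L" for c
  proof -
    obtain L where "(\<lambda>N. \<Prod>k<N. 1 + c * ?q * ?q ^ k) \<longlonglongrightarrow> L"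
      using prod_one_plus_tendsto[OF summable_norm_geometric_e2pi[OF assms, of "c * ?q"]] by blast
    then show ?thesis by (intro exI[of _ L]) (simp add: mult.assoc)
  qed
  obtain A where A: "a \<longlonglongrightarrow> A" unfolding a_def using conv by blast
  obtain B where B: "b \<longlonglongrightarrow> B" unfolding b_def using conv by blast
  have "qpoch ?q N * a N * b N = qpoch (e2pi (3 * \<tau>)) N" for N
  proof -
    have cyc: "(1 - y) * (1 + e2pi (1/6) * y) * (1 + e2pi (- (1/6)) * y) = 1 - y ^ 3" for y
    proof -
      have s: "e2pi (1/6) + e2pi (- (1/6)) = 1" "e2pi (1/6) * e2pi (- (1/6)) = 1"
        by (simp_all add: e2pi_sixth e2pi_minus_sixth complex_eq_iff)
      have "(1 + e2pi (1/6) * y) * (1 + e2pi (- (1/6)) * y)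
          = 1 + (e2pi (1/6) + e2pi (- (1/6))) * y + (e2pi (1/6) * e2pi (- (1/6))) * y ^ 2"
        by (simp add: algebra_simps power2_eq_square)
      then have "(1 + e2pi (1/6) * y) * (1 + e2pi (- (1/6)) * y) = 1 + y + y ^ 2"
        unfolding s by simp
      then show ?thesis
        unfolding mult.assoc by (simp add: algebra_simps power2_eq_square power3_eq_cube)
    qed
    have p: "(?q ^ Suc k) ^ 3 = e2pi (3 * \<tau>) ^ Suc k" for k
      unfolding e2pi_power by (simp add: mult_ac)
    show ?thesis
      unfolding qpoch_def a_def b_def prod.distrib[symmetric] cyc p ..
  qed
  then have "(\<lambda>N. qpoch (e2pi (3 * \<tau>)) N) \<longlonglongrightarrow> euler_prod \<tau> * A * B"
    using tendsto_mult[OF tendsto_mult[OF qpoch_tendsto(1)[OF assms] A] B] by simp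
  from LIMSEQ_unique[OF this qpoch_tendsto(1)[OF y3]]
  have AB: "euler_prod \<tau> * A * B = euler_prod (3 * \<tau>)" .
  have C: "(1 + e2pi (- (1/6))) * e2pi (\<tau> / 8 + 1/6/2) = of_real (sqrt 3) * e2pi (\<tau> / 8)"
  proof -
    have "(1 + e2pi (- (1/6))) * e2pi (1/12) = of_real (sqrt 3)"
      by (simp add: e2pi_minus_sixth e2pi_twelfth complex_eq_iff field_simps)
    then show ?thesis by (simp add: e2pi_add mult_ac)
  qed
  have "(\<lambda>M. (1 + e2pi (- (1/6))) * (e2pi (\<tau> / 8 + 1/6/2) * a (Suc M) * b M))
      \<longlonglongrightarrow> (1 + e2pi (- (1/6))) * (e2pi (\<tau> / 8 + 1/6/2) * A * B)"
    by (intro tendsto_mult tendsto_const LIMSEQ_Suc A B)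
  then have "(\<lambda>M. theta_product (1/2) \<tau> (Suc M) (1/6))
      \<longlonglongrightarrow> (1 + e2pi (- (1/6))) * (e2pi (\<tau> / 8 + 1/6/2) * A * B)"
    unfolding theta_product_half_Suc a_def b_def .
  from LIMSEQ_unique[OF LIMSEQ_Suc[OF theta_product_tendsto[OF assms]] this]
  have "theta (1/2) \<tau> (1/6) = ((1 + e2pi (- (1/6))) * e2pi (\<tau> / 8 + 1/6/2)) * (euler_prod \<tau> * A * B)"
    using qpoch_tendsto(2)[OF assms] by (simp add: divide_eq_eq mult_ac)
  then show ?thesis unfolding AB C by simp
qed

text \<open>Both sides are multiples of \<open>e(3\<tau>/8)\<close> times the cube of the Euler function at \<open>3\<tau>\<close>.\<close>
lemma deriv_theta_half_half_3:
  assumes "Im \<tau> > 0"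
  shows "3 * of_real (sqrt 3) * deriv (theta (1/2) (3 * \<tau>)) (1/2) = - 2 * of_real pi * theta (1/2) \<tau> (1/6) ^ 3"
proof -
  have s: "(of_real (sqrt 3) :: complex) ^ 3 = 3 * of_real (sqrt 3)"
    by (simp add: power3_eq_cube flip: of_real_mult)
  have "e2pi (\<tau> / 8) ^ 3 = e2pi (3 * \<tau> / 8)" unfolding e2pi_power by simp
  then have "theta (1/2) \<tau> (1/6) ^ 3 = 3 * of_real (sqrt 3) * e2pi (3 * \<tau> / 8) * euler_prod (3 * \<tau>) ^ 3"
    unfolding theta_half_sixth[OF assms] power_mult_distrib s by simp
  moreover have "deriv (theta (1/2) (3 * \<tau>)) (1/2) = - 2 * of_real pi * e2pi (3 * \<tau> / 8) * euler_prod (3 * \<tau>) ^ 3"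
    by (rule deriv_theta_half_half) (use assms in simp)
  ultimately show ?thesis by simp
qed

section \<open>Logarithmic derivatives at the three-division points\<close>

text \<open>\<open>\<alpha>\<close> is a logarithmic derivative of \<open>theta r \<tau>\<close> at \<open>u\<close>, stated without dividing by the value.\<close>
definition theta_logderiv :: "real \<Rightarrow> complex \<Rightarrow> complex \<Rightarrow> complex \<Rightarrow> bool" where
  "theta_logderiv r \<tau> u \<alpha> \<longleftrightarrow> deriv (theta r \<tau>) u = \<alpha> * theta r \<tau> u"

lemma theta_logderiv_add_one:
  assumes "Im \<tau> > 0"
  shows "theta_logderiv r \<tau> (u + 1) \<alpha> \<longleftrightarrow> theta_logderiv r \<tau> u \<alpha>"
  by (simp add: theta_logderiv_def theta_add_one deriv_theta_add_one[OF assms])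

lemma theta_logderiv_shift_one: "theta_logderiv (r + 1) \<tau> u \<alpha> \<longleftrightarrow> theta_logderiv r \<tau> u \<alpha>"
  by (simp add: theta_logderiv_def theta_shift_one deriv_theta_shift_one)

lemma theta_logderiv_minus:
  assumes "Im \<tau> > 0"
  shows "theta_logderiv (- r) \<tau> (- u) (- \<alpha>) \<longleftrightarrow> theta_logderiv r \<tau> u \<alpha>"
  by (simp add: theta_logderiv_def theta_minus deriv_theta_minus[OF assms])

text \<open>The identity of \<open>theta_cubed\<close> for \<open>r = 1/2\<close> reads \<open>A(u)\<^sup>3 = a B(3u) + c (F(3u) + F(-3u))\<close>.
  It yields the three relations \<open>I\<close>, \<open>II\<close>, \<open>III\<close> once all values of \<open>F\<close> and \<open>F'\<close> are carried by
  quasi-periodicity to a single point. Relation \<open>J\<close> from the triple product ties \<open>B'(1/2)\<close> to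
  \<open>A(1/6)\<^sup>3\<close>. Relations \<open>III\<close> and \<open>J\<close> give the first logarithmic derivative;
  \<open>I\<close>, \<open>II\<close> and \<open>J\<close>, after cancelling \<open>c\<close>, give the second.\<close>
lemma theta_logderivs_third:
  assumes "Im \<tau> > 0"
  shows "theta_logderiv (1/2) \<tau> (1/6) (- (of_real pi / of_real (sqrt 3)) * Theta3 (2 * \<tau>))"
    and "theta_logderiv (1/6) (3 * \<tau>) (1/2) (of_real pi * \<i> / 3 * Theta3 (2 * \<tau>))"
proof -
  have y3: "Im (3 * \<tau>) > 0" using assms by simp
  let ?A = "theta (1/2) \<tau>" and ?B = "theta (1/2) (3 * \<tau>)" and ?F = "theta (1/6) (3 * \<tau>)"
  define a where "a = Theta3 (2 * \<tau>)"
  define c where "c = A2_coset_theta 1 \<tau>"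
  define w where "w = e2pi (1/6)"
  have w2: "w * w = w - 1"
    by (simp add: w_def e2pi_sixth complex_eq_iff)
  have "theta (1/2 + 1/3) (3 * \<tau>) v = ?F (- v)" for v
    using theta_shift_one[of "- (1/6)" "3 * \<tau>" v] theta_minus[of "1/6" "3 * \<tau>" "- v"] by simp
  moreover have "theta (1/2 + 2/3) (3 * \<tau>) v = ?F v" for v
    using theta_shift_one[of "1/6" "3 * \<tau>" v] by simp
  ultimately have cube: "?A u ^ 3 = a * ?B (3 * u) + c * (?F (3 * u) + ?F (- (3 * u)))" for u
    unfolding theta_cubed[OF assms] a_def c_def Theta3_eq_A2_coset_theta A2_coset_theta_2
    by (simp add: algebra_simps)
  (* a common factor 3 has been divided out *)
  have Dcube: "?A u ^ 2 * deriv ?A u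
      = a * deriv ?B (3 * u) + c * (deriv ?F (3 * u) - deriv ?F (- (3 * u)))" for u
  proof -
    have "((\<lambda>u. ?A u ^ 3) has_field_derivative 3 * ?A u ^ 2 * deriv ?A u) (at u)"
      by (rule derivative_eq_intros theta_DERIV[OF assms] refl)+ simp
    moreover have "((\<lambda>u. ?A u ^ 3) has_field_derivative
        a * (deriv ?B (3 * u) * 3) + c * (deriv ?F (3 * u) * 3 + deriv ?F (- (3 * u)) * (- 3))) (at u)"
      unfolding cube
      by (intro DERIV_add DERIV_cmult theta_DERIV_compose[OF y3]) (auto intro!: derivative_eq_intros)
    ultimately have "3 * ?A u ^ 2 * deriv ?A u
        = a * (deriv ?B (3 * u) * 3) + c * (deriv ?F (3 * u) * 3 + deriv ?F (- (3 * u)) * (- 3))"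
      by (rule DERIV_unique)
    then have "3 * (?A u ^ 2 * deriv ?A u)
      = 3 * (a * deriv ?B (3 * u) + c * (deriv ?F (3 * u) - deriv ?F (- (3 * u))))"
      by (simp add: algebra_simps)
    moreover have "(3 :: complex) \<noteq> 0" by simp
    ultimately show ?thesis using mult_left_cancel by blast
  qed
  define p where "p = ?F (- (1/2))"
  define p' where "p' = deriv ?F (- (3/2))"
  define b where "b = deriv ?B (1/2)"
  (* everything is expressed by p = F(-1/2) and p' = F'(-3/2); moving by 1 multiplies by w = e(1/6) *)
  have F1: "?F (1/2) = w * p"
    using theta_add_one[of "1/6" "3 * \<tau>" "- (1/2)"] by (simp add: p_def w_def)
  have F2: "deriv ?F (- (1/2)) = w * p'"
    using deriv_theta_add_one[OF y3, of "1/6" "- (3/2)"] by (simp add: p'_def w_def)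
  have F3: "deriv ?F (1/2) = (w - 1) * p'"
    using deriv_theta_add_one[OF y3, of "1/6" "- (1/2)"] w2
    by (simp add: F2 flip: w_def mult.assoc)
  have F4: "deriv ?F (3/2) = - p'"
  proof -
    have "w * (w - 1) = - 1" using w2 by (simp add: algebra_simps)
    then show ?thesis
      using deriv_theta_add_one[OF y3, of "1/6" "1/2"] by (simp add: F3 flip: w_def mult.assoc)
  qed
  have B1: "deriv ?B (3/2) = - b"
    using deriv_theta_add_one[OF y3, of "1/2" "1/2"] by (simp add: b_def e2pi_half)
  (* derivative of the cube identity at its zero u = 1/2 *)
  have I: "a * b = - 2 * c * p'"
  proof -
    have "0 = a * (- b) + c * (- p' - p')"
      using Dcube[of "1/2"] by (simp add: theta_half_half B1 F4 flip: p'_def)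
    then show ?thesis by (simp add: algebra_simps)
  qed
  have II: "?A (1/6) ^ 3 = c * p * (1 + w)"
  proof -
    have "?A (1/6) ^ 3 = c * (w * p + p)"
      using cube[of "1/6"] by (simp add: theta_half_half F1 flip: p_def)
    then show ?thesis by (simp add: algebra_simps)
  qed
  have III: "2 * (?A (1/6) ^ 2 * deriv ?A (1/6)) = 3 * (a * b)"
  proof -
    have "?A (1/6) ^ 2 * deriv ?A (1/6) = a * b + c * ((w - 1) * p' - w * p')"
      using Dcube[of "1/6"] by (simp add: F2 F3 flip: b_def)
    then show ?thesis using I by (simp add: algebra_simps)
  qed
  have J: "3 * of_real (sqrt 3) * b = - 2 * of_real pi * ?A (1/6) ^ 3"
    unfolding b_def by (rule deriv_theta_half_half_3[OF assms])
  have A0: "?A (1/6) \<noteq> 0"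
    by (rule theta_nonzero[OF assms]) (auto simp: e2pi_sixth complex_eq_iff)
  have s0: "of_real (sqrt 3) \<noteq> (0 :: complex)" by simp
  have cancel: "x = y" if "k * x = k * y" "k \<noteq> 0" for k x y :: complex
    using that by simp
  have "?A (1/6) ^ 2 * (of_real (sqrt 3) * deriv ?A (1/6)) = ?A (1/6) ^ 2 * (- of_real pi * a * ?A (1/6))"
  proof -
    have "2 * (?A (1/6) ^ 2 * (of_real (sqrt 3) * deriv ?A (1/6)))
        = of_real (sqrt 3) * (2 * (?A (1/6) ^ 2 * deriv ?A (1/6)))"
      by simp
    also have "\<dots> = a * (3 * of_real (sqrt 3) * b)"
      unfolding III by simp
    also have "\<dots> = 2 * (?A (1/6) ^ 2 * (- of_real pi * a * ?A (1/6)))"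
      unfolding J by (simp add: power3_eq_cube power2_eq_square)
    finally show ?thesis by (rule cancel) simp
  qed
  then have "of_real (sqrt 3) * deriv ?A (1/6) = - of_real pi * a * ?A (1/6)"
    by (rule cancel) (use A0 in simp)
  also have "\<dots> = of_real (sqrt 3) * (- (of_real pi / of_real (sqrt 3)) * a * ?A (1/6))"
    using s0 by simp
  finally have "deriv ?A (1/6) = - (of_real pi / of_real (sqrt 3)) * a * ?A (1/6)"
    by (rule cancel) (rule s0)
  then show "theta_logderiv (1/2) \<tau> (1/6) (- (of_real pi / of_real (sqrt 3)) * Theta3 (2 * \<tau>))"
    unfolding theta_logderiv_def a_def[symmetric] .
  have c0: "c \<noteq> 0" using II A0 by auto
  have ww: "w * (1 + w) = \<i> * of_real (sqrt 3)"
    by (simp add: w_def e2pi_sixth complex_eq_iff)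
  have "c * (3 * of_real (sqrt 3) * p') = c * (of_real pi * a * p * (1 + w))"
  proof -
    have "2 * (c * (3 * of_real (sqrt 3) * p')) = - (3 * of_real (sqrt 3)) * (- 2 * c * p')"
      by simp
    also have "\<dots> = - a * (3 * of_real (sqrt 3) * b)"
      unfolding I[symmetric] by simp
    also have "\<dots> = 2 * (c * (of_real pi * a * p * (1 + w)))"
      unfolding J II by (simp add: mult_ac)
    finally show ?thesis by (rule cancel) simp
  qed
  then have "3 * of_real (sqrt 3) * p' = of_real pi * a * p * (1 + w)" by (rule cancel) (rule c0)
  then have "(w * w) * (3 * of_real (sqrt 3) * p') = of_real pi * a * (w * p) * (w * (1 + w))"
    by (simp add: mult_ac)
  then have "of_real (sqrt 3) * (3 * deriv ?F (1/2)) = of_real (sqrt 3) * (of_real pi * \<i> * a * ?F (1/2))"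
    unfolding ww w2 F3 F1 by (simp add: mult_ac)
  then have "3 * deriv ?F (1/2) = of_real pi * \<i> * a * ?F (1/2)" by (rule cancel) (rule s0)
  then have "3 * deriv ?F (1/2) = 3 * (of_real pi * \<i> / 3 * a * ?F (1/2))" by simp
  then have "deriv ?F (1/2) = of_real pi * \<i> / 3 * a * ?F (1/2)" by (rule cancel) simp
  then show "theta_logderiv (1/6) (3 * \<tau>) (1/2) (of_real pi * \<i> / 3 * Theta3 (2 * \<tau>))"
    unfolding theta_logderiv_def a_def[symmetric] .
qed

section \<open>Duplication formulas\<close>

text \<open>In the product formula of \<open>theta_mult_theta\<close> the term with \<open>j = 1\<close> contains the
  value \<open>theta (1/2) (2 * \<tau>) (- 1/2)\<close>, which is zero.\<close>
lemma theta_duplication_argument: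
  assumes "Im \<tau> > 0"
  shows "theta r \<tau> u * theta r \<tau> (u + 1/2) = theta 0 (2 * \<tau>) (1/2) * theta r (2 * \<tau>) (2 * u + 1/2)"
proof -
  have "theta (1/2) (2 * \<tau>) (- (1/2)) = 0"
    using theta_add_one[of "1/2" "2 * \<tau>" "- (1/2)"] by (simp add: theta_half_half)
  moreover have "theta 0 (2 * \<tau>) (- (1/2)) = theta 0 (2 * \<tau>) (1/2)"
    using theta_minus[of 0 "2 * \<tau>" "1/2"] by simp
  ultimately show ?thesis
    unfolding theta_mult_theta[OF assms] by (simp add: mult_ac)
qed

text \<open>Splitting the index \<open>n\<close> of \<open>theta (2 * r) (\<tau> / 2) u\<close> by parity.\<close>
lemma theta_even_odd:
  assumes "Im \<tau> > 0"
  shows "theta r (2 * \<tau>) (2 * u) + theta (r + 1/2) (2 * \<tau>) (2 * u) = theta (2 * r) (\<tau> / 2) u"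
proof -
  have y: "Im (\<tau> / 2) > 0" using assms by simp
  let ?t = "theta_term (2 * r) (\<tau> / 2) u"
  have s: "?t summable_on S" for S
    using has_sum_imp_summable[OF theta_has_sum[OF y]] by (rule summable_on_subset) auto
  have split: "UNIV = range (\<lambda>n::int. 2 * n) \<union> range (\<lambda>n. 2 * n + 1)"
    by (auto simp: image_iff) presburger
  have "theta (2 * r) (\<tau> / 2) u = infsum ?t (range (\<lambda>n::int. 2 * n)) + infsum ?t (range (\<lambda>n. 2 * n + 1))"
    unfolding theta_def by (subst split, rule infsum_Un_disjoint[OF s s]) (auto, presburger)
  also have "infsum ?t (range (\<lambda>n::int. 2 * n)) = theta r (2 * \<tau>) (2 * u)"
    unfolding theta_def
  proof (subst infsum_reindex, simp add: inj_def, intro infsum_cong)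
    fix n :: int
    show "(?t \<circ> (*) 2) n = theta_term r (2 * \<tau>) (2 * u) n"
      unfolding theta_term_def o_def by (intro arg_cong[of _ _ e2pi]) (simp add: power2_eq_square field_simps)
  qed
  also have "infsum ?t (range (\<lambda>n::int. 2 * n + 1)) = theta (r + 1/2) (2 * \<tau>) (2 * u)"
    unfolding theta_def
  proof (subst infsum_reindex, simp add: inj_def, intro infsum_cong)
    fix n :: int
    show "(?t \<circ> (\<lambda>n. 2 * n + 1)) n = theta_term (r + 1/2) (2 * \<tau>) (2 * u) n"
      unfolding theta_term_def o_def by (intro arg_cong[of _ _ e2pi]) (simp add: power2_eq_square field_simps)
  qed
  finally show ?thesis ..
qed

text \<open>Here both terms of the product formula have the same second factor, by evenness, and the first factors
  are the even and odd halves of one theta series.\<close>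
lemma theta_duplication_characteristic:
  assumes "Im \<tau> > 0"
  shows "theta r \<tau> u * theta (r + 1/2) \<tau> u = theta (1/4) (2 * \<tau>) 0 * theta (2 * r + 1/2) (\<tau> / 2) u"
proof -
  have 1: "(r + (r + 1/2)) / 2 = r + 1/4" "(r - (r + 1/2)) / 2 = - (1/4)"
    "(r + (r + 1/2) + 1) / 2 = r + 1/4 + 1/2" "(r - (r + 1/2) + 1) / 2 = 1/4"
    by (simp_all add: field_simps)
  have 2: "theta (- (1/4)) (2 * \<tau>) 0 = theta (1/4) (2 * \<tau>) 0"
    using theta_minus[of "1/4" "2 * \<tau>" 0] by simp
  have 3: "theta (2 * r + 1/2) (\<tau> / 2) u
      = theta (r + 1/4) (2 * \<tau>) (2 * u) + theta (r + 1/4 + 1/2) (2 * \<tau>) (2 * u)"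
    using theta_even_odd[OF assms, of "r + 1/4" u] by (simp add: ring_distribs)
  show ?thesis
    unfolding theta_mult_theta[OF assms] 1 diff_self 2 3 by (simp add: algebra_simps)
qed

lemma logderiv_of_product:
  fixes f g h :: "complex \<Rightarrow> complex"
  assumes prod: "\<And>v. f v * g v = K * h v"
    and f: "(f has_field_derivative \<alpha> * f u) (at u)" and g: "(g has_field_derivative g') (at u)"
    and h: "(h has_field_derivative \<beta> * h u) (at u)" and "f u \<noteq> 0"
  shows "g' = (\<beta> - \<alpha>) * g u"
proof -
  have "((\<lambda>v. f v * g v) has_field_derivative (\<alpha> * f u) * g u + g' * f u) (at u)"
    by (rule DERIV_mult[OF f g])
  moreover have "((\<lambda>v. f v * g v) has_field_derivative K * (\<beta> * h u)) (at u)"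
    unfolding prod by (rule DERIV_cmult[OF h])
  ultimately have "(\<alpha> * f u) * g u + g' * f u = \<beta> * (K * h u)"
    using DERIV_unique by fastforce
  then have "f u * g' = f u * ((\<beta> - \<alpha>) * g u)"
    unfolding prod[symmetric] by (simp add: algebra_simps)
  then show ?thesis using assms(5) by simp
qed

lemma theta_logderiv_duplication_argument:
  assumes "Im \<tau> > 0" "theta r \<tau> u \<noteq> 0"
    and \<alpha>: "theta_logderiv r \<tau> u \<alpha>" and \<beta>: "theta_logderiv r (2 * \<tau>) (2 * u + 1/2) \<beta>"
  shows "theta_logderiv r \<tau> (u + 1/2) (2 * \<beta> - \<alpha>)"
  unfolding theta_logderiv_def
proof (rule logderiv_of_product[OF theta_duplication_argument[OF assms(1)]])
  have y2: "Im (2 * \<tau>) > 0" using assms by simp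
  show "(theta r \<tau> has_field_derivative \<alpha> * theta r \<tau> u) (at u)"
    using theta_DERIV[OF assms(1), of r u] \<alpha> by (simp add: theta_logderiv_def)
  have "((\<lambda>u. theta r \<tau> (u + 1/2)) has_field_derivative deriv (theta r \<tau>) (u + 1/2) * 1) (at u)"
    by (rule theta_DERIV_compose[OF assms(1)]) (auto intro!: derivative_eq_intros)
  then show "((\<lambda>u. theta r \<tau> (u + 1/2)) has_field_derivative deriv (theta r \<tau>) (u + 1/2)) (at u)"
    by simp
  have "((\<lambda>u. theta r (2 * \<tau>) (2 * u + 1/2)) has_field_derivative
      deriv (theta r (2 * \<tau>)) (2 * u + 1/2) * 2) (at u)"
    by (rule theta_DERIV_compose[OF y2]) (auto intro!: derivative_eq_intros)
  then show "((\<lambda>u. theta r (2 * \<tau>) (2 * u + 1/2)) has_field_derivative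
      2 * \<beta> * theta r (2 * \<tau>) (2 * u + 1/2)) (at u)"
    using \<beta> by (simp add: theta_logderiv_def mult_ac)
qed (fact assms(2))

lemma theta_logderiv_duplication_characteristic:
  assumes "Im \<tau> > 0" "theta r \<tau> u \<noteq> 0"
    and \<alpha>: "theta_logderiv r \<tau> u \<alpha>" and \<beta>: "theta_logderiv (2 * r + 1/2) (\<tau> / 2) u \<beta>"
  shows "theta_logderiv (r + 1/2) \<tau> u (\<beta> - \<alpha>)"
  unfolding theta_logderiv_def
proof (rule logderiv_of_product[OF theta_duplication_characteristic[OF assms(1)]])
  have y2: "Im (\<tau> / 2) > 0" using assms by simp
  show "(theta r \<tau> has_field_derivative \<alpha> * theta r \<tau> u) (at u)"
    using theta_DERIV[OF assms(1), of r u] \<alpha> by (simp add: theta_logderiv_def)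
  show "(theta (r + 1/2) \<tau> has_field_derivative deriv (theta (r + 1/2) \<tau>) u) (at u)"
    by (rule theta_DERIV[OF assms(1)])
  show "(theta (2 * r + 1/2) (\<tau> / 2) has_field_derivative \<beta> * theta (2 * r + 1/2) (\<tau> / 2) u) (at u)"
    using theta_DERIV[OF y2, of "2 * r + 1/2" u] \<beta> by (simp add: theta_logderiv_def)
qed (fact assms(2))

section \<open>The eight logarithmic derivatives\<close>

theorem theorem3p1:
  fixes \<tau> :: complex
  assumes "Im \<tau> > 0"
  shows
    "deriv (\<lambda>z. theta_char 1 (1/3) \<tau> z) 0
       = - (of_real pi / of_real (sqrt 3)) * theta_char 1 (1/3) \<tau> 0 * Theta3 (2 * \<tau>)
   \<and> deriv (\<lambda>z. theta_char 0 (1/3) \<tau> z) 0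
       = - (of_real pi / of_real (sqrt 3)) * theta_char 0 (1/3) \<tau> 0
           * (Theta3 \<tau> - Theta3 (2 * \<tau>))
   \<and> deriv (\<lambda>z. theta_char (1/3) 1 \<tau> z) 0
       = (of_real pi * \<i> / 3) * theta_char (1/3) 1 \<tau> 0 * Theta3 (2 * \<tau> / 3)
   \<and> deriv (\<lambda>z. theta_char (1/3) 0 \<tau> z) 0
       = (of_real pi * \<i> / 3) * theta_char (1/3) 0 \<tau> 0
           * (2 * Theta3 (4 * \<tau> / 3) - Theta3 (2 * \<tau> / 3))
   \<and> deriv (\<lambda>z. theta_char 1 (2/3) \<tau> z) 0
       = - (of_real pi / of_real (sqrt 3)) * theta_char 1 (2/3) \<tau> 0
           * (2 * Theta3 (4 * \<tau>) + Theta3 (2 * \<tau>))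
   \<and> deriv (\<lambda>z. theta_char 0 (2/3) \<tau> z) 0
       = - (of_real pi / of_real (sqrt 3)) * theta_char 0 (2/3) \<tau> 0
           * (Theta3 \<tau> + Theta3 (2 * \<tau>) - 2 * Theta3 (4 * \<tau>))
   \<and> deriv (\<lambda>z. theta_char (2/3) 1 \<tau> z) 0
       = (of_real pi * \<i> / 3) * theta_char (2/3) 1 \<tau> 0
           * (Theta3 (\<tau> / 3) + Theta3 (2 * \<tau> / 3))
   \<and> deriv (\<lambda>z. theta_char (2/3) 0 \<tau> z) 0
       = (of_real pi * \<i> / 3) * theta_char (2/3) 0 \<tau> 0
           * (2 * Theta3 (4 * \<tau> / 3) - Theta3 (\<tau> / 3) + Theta3 (2 * \<tau> / 3))"
proof -
  define \<rho> :: complex where "\<rho> = - (of_real pi / of_real (sqrt 3))"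
  define R where "R t = \<rho> * Theta3 (2 * t)" for t
  define T where "T t = of_real pi * \<i> / 3 * Theta3 (2 * t / 3)" for t
  have R6: "theta_logderiv (1/2) t (1/6) (R t)" if "Im t > 0" for t
    unfolding R_def \<rho>_def by (rule theta_logderivs_third(1)[OF that])
  have T6: "theta_logderiv (1/6) t (1/2) (T t)" if "Im t > 0" for t
    using theta_logderivs_third(2)[of "t / 3"] that by (simp add: T_def)
  (* duplication from u = -1/6: there u + 1/2 = 1/3, and 2 u + 1/2 = 1/6 is again known *)
  have R3: "theta_logderiv (1/2) t (1/3) (2 * R (2 * t) + R t)" if t: "Im t > 0" for t
  proof -
    have "theta_logderiv (- (1/2)) t (- (1/6)) (- R t)"
      using R6[OF t] by (simp add: theta_logderiv_minus[OF t])
    then have "theta_logderiv (1/2) t (- (1/6)) (- R t)"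
      using theta_logderiv_shift_one[of "- (1/2)" t] by simp
    moreover have "theta (1/2) t (- (1/6)) \<noteq> 0"
      by (rule theta_nonzero[OF t]) (auto simp: e2pi_minus_sixth complex_eq_iff)
    moreover have "theta_logderiv (1/2) (2 * t) (2 * (- (1/6)) + 1/2) (R (2 * t))"
      using R6[of "2 * t"] t by simp
    ultimately show ?thesis
      using theta_logderiv_duplication_argument[OF t, of "1/2" "- (1/6)" "- R t" "R (2 * t)"]
      by simp
  qed
  have T6': "theta_logderiv (1/6) t (- (1/2)) (T t)" if "Im t > 0" for t
    using T6[OF that] theta_logderiv_add_one[OF that, of "1/6" "- (1/2)"] by simp
  (* duplication from r = -1/6: there r + 1/2 = 1/3, and 2 r + 1/2 = 1/6 is again known *)
  have T3: "theta_logderiv (1/3) t (1/2) (T (t / 2) + T t)" if t: "Im t > 0" for t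
  proof -
    have "theta_logderiv (- (1/6)) t (1/2) (- T t)"
      using theta_logderiv_minus[OF t, of "1/6" "- (1/2)"] T6'[OF t] by simp
    moreover have "theta (- (1/6)) t (1/2) \<noteq> 0"
      by (rule theta_nonzero[OF t]) auto
    moreover have "theta_logderiv (2 * (- (1/6)) + 1/2) (t / 2) (1/2) (T (t / 2))"
      using T6[of "t / 2"] t by simp
    ultimately show ?thesis
      using theta_logderiv_duplication_characteristic[OF t, of "- (1/6)" "1/2" "- T t" "T (t / 2)"]
      by simp
  qed
  have T3': "theta_logderiv (1/3) t (- (1/2)) (T (t / 2) + T t)" if "Im t > 0" for t
    using T3[OF that] theta_logderiv_add_one[OF that, of "1/3" "- (1/2)"] by simp

  (* r = -1/2 and r = 1/2 give the same function, and 2 r + 1/2 = -1/2 as well *)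
  have zero_char: "theta_logderiv 0 \<tau> u (\<beta> - \<alpha>)"
    if \<alpha>: "theta_logderiv (1/2) \<tau> u \<alpha>" and \<beta>: "theta_logderiv (1/2) (\<tau> / 2) u \<beta>"
      and u: "Im u = 0" "e2pi u \<noteq> - 1" for u \<alpha> \<beta>
  proof -
    have "theta (- (1/2)) \<tau> u \<noteq> 0"
      using theta_nonzero[OF assms u(1), of "1/2"] u(2) theta_shift_one[of "- (1/2)" \<tau> u] by simp
    moreover have "theta_logderiv (- (1/2)) \<tau> u \<alpha>"
      using \<alpha> theta_logderiv_shift_one[of "- (1/2)" \<tau> u] by simp
    moreover have "theta_logderiv (- (1/2)) (\<tau> / 2) u \<beta>"
      using \<beta> theta_logderiv_shift_one[of "- (1/2)" "\<tau> / 2" u] by simp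
    ultimately show ?thesis
      using theta_logderiv_duplication_characteristic[OF assms, of "- (1/2)" u \<alpha> \<beta>] by simp
  qed
  (* duplication from u = -1/2, where also 2 u + 1/2 = -1/2 *)
  have zero_arg: "theta_logderiv r \<tau> 0 (2 * \<beta> - \<alpha>)"
    if \<alpha>: "theta_logderiv r \<tau> (- (1/2)) \<alpha>" and \<beta>: "theta_logderiv r (2 * \<tau>) (- (1/2)) \<beta>"
      and r: "\<bar>r\<bar> < 1/2" for r \<alpha> \<beta>
    using theta_logderiv_duplication_argument[OF assms, of r "- (1/2)" \<alpha> \<beta>]
      theta_nonzero[OF assms, of "- (1/2)" r] \<alpha> \<beta> r by simp

  have half_t: "Im (\<tau> / 2) > 0" and double_t: "Im (2 * \<tau>) > 0" using assms by simp_all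
  have third: "e2pi (1/3) \<noteq> - 1"
    using e2pi_of_real[of "1/3"] by (simp add: complex_eq_iff cos_120)
  have conv: "deriv (\<lambda>z. theta_char \<epsilon> \<delta> \<tau> z) 0 = \<alpha> * theta_char \<epsilon> \<delta> \<tau> 0"
    if "theta_logderiv (\<epsilon> / 2) \<tau> (of_real \<delta> / 2) \<alpha>" for \<epsilon> \<delta> \<alpha>
    using that unfolding deriv_theta_char[OF assms] theta_logderiv_def by (simp add: theta_char_eq)
  have 1: "deriv (\<lambda>z. theta_char 1 (1/3) \<tau> z) 0 = R \<tau> * theta_char 1 (1/3) \<tau> 0"
    by (rule conv) (use R6[OF assms] in simp)
  have 2: "deriv (\<lambda>z. theta_char 0 (1/3) \<tau> z) 0 = (R (\<tau> / 2) - R \<tau>) * theta_char 0 (1/3) \<tau> 0"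
    by (rule conv) (use zero_char[OF R6[OF assms] R6[OF half_t]] in \<open>simp add: e2pi_sixth complex_eq_iff\<close>)
  have 3: "deriv (\<lambda>z. theta_char (1/3) 1 \<tau> z) 0 = T \<tau> * theta_char (1/3) 1 \<tau> 0"
    by (rule conv) (use T6[OF assms] in simp)
  have 4: "deriv (\<lambda>z. theta_char (1/3) 0 \<tau> z) 0 = (2 * T (2 * \<tau>) - T \<tau>) * theta_char (1/3) 0 \<tau> 0"
    by (rule conv) (use zero_arg[OF T6'[OF assms] T6'[OF double_t]] in simp)
  have 5: "deriv (\<lambda>z. theta_char 1 (2/3) \<tau> z) 0 = (2 * R (2 * \<tau>) + R \<tau>) * theta_char 1 (2/3) \<tau> 0"
    by (rule conv) (use R3[OF assms] in simp)
  have 6: "deriv (\<lambda>z. theta_char 0 (2/3) \<tau> z) 0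
      = (2 * R \<tau> + R (\<tau> / 2) - (2 * R (2 * \<tau>) + R \<tau>)) * theta_char 0 (2/3) \<tau> 0"
    by (rule conv) (use zero_char[OF R3[OF assms] R3[OF half_t] _ third] in simp)
  have 7: "deriv (\<lambda>z. theta_char (2/3) 1 \<tau> z) 0 = (T (\<tau> / 2) + T \<tau>) * theta_char (2/3) 1 \<tau> 0"
    by (rule conv) (use T3[OF assms] in simp)
  have 8: "deriv (\<lambda>z. theta_char (2/3) 0 \<tau> z) 0
      = (2 * (T \<tau> + T (2 * \<tau>)) - (T (\<tau> / 2) + T \<tau>)) * theta_char (2/3) 0 \<tau> 0"
    by (rule conv) (use zero_arg[OF T3'[OF assms] T3'[OF double_t]] in simp)
  show ?thesis
    unfolding 1 2 3 4 5 6 7 8 R_def T_def \<rho>_def[symmetric] by (simp add: algebra_simps)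
qed

end
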